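(* Let $0<w\in L^1(\mathbb R)\cap L^\infty(\mathbb R)$ and let $\alpha\in\mathbb C$ with $|\alpha|=1$. Let $H_w=-\frac{i}{w}\frac{d}{dx}$ and $$D^\alpha=\left\{f\in L^2_w(\mathbb R)\ \Big|\ H_wf\in L^2_w(\mathbb R),\ \lim_{x\to\infty}f(x)=\alpha\lim_{x\to-\infty}f(x)\right\}.$$ Then the operator $H_w:D^\alpha\subset L^2_w(\mathbb R)\to L^2_w(\mathbb R)$ is essentially self-adjoint.
   Context: $L^2_w(\mathbb R)$ is the Hilbert space of functions $f:\mathbb R\to\mathbb C$ with $\|f\|^2_{L^2_w(\mathbb R)}:=\int_{\mathbb R}|f|^2w\,dx<\infty$, with inner product $(f,g)_{L^2_w(\mathbb R)}=\int_{\mathbb R}f\overline g\,w\,dx$. The derivative in $H_wf$ is understood in the weak sense, so that elements of $D^\alpha$ are (represented by) locally absolutely continuous functions. *)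

theory Defs
  imports "HOL-Analysis.Analysis"
begin

section \<open>The weighted space\<close>

text \<open>
  Elements of the weighted space are handled through representatives: functions on the real line
  that are only relevant up to equality almost everywhere. For a weight that is positive almost
  everywhere, null sets for Lebesgue measure and for the weighted measure are the same.
\<close>

definition L2w :: "(real \<Rightarrow> real) \<Rightarrow> (real \<Rightarrow> complex) set" where
  "L2w w = {f. f \<in> borel_measurable lebesgue \<and>
               integrable lebesgue (\<lambda>x. (cmod (f x))\<^sup>2 * w x)}"

definition inner_w :: "(real \<Rightarrow> real) \<Rightarrow> (real \<Rightarrow> complex) \<Rightarrow> (real \<Rightarrow> complex) \<Rightarrow> complex" where
  "inner_w w f g = (LINT x|lebesgue. f x * cnj (g x) * complex_of_real (w x))"

definition norm_w :: "(real \<Rightarrow> real) \<Rightarrow> (real \<Rightarrow> complex) \<Rightarrow> real" where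
  "norm_w w f = sqrt (LINT x|lebesgue. (cmod (f x))\<^sup>2 * w x)"

definition ae_eq :: "(real \<Rightarrow> complex) \<Rightarrow> (real \<Rightarrow> complex) \<Rightarrow> bool" where
  "ae_eq f g \<longleftrightarrow> (AE x in lebesgue. f x = g x)"


section \<open>Unbounded operators\<close>

text \<open>
  An unbounded operator is given by its graph, a set of pairs of representatives.
  The last two conjuncts say that the graph is a union of classes modulo equality almost
  everywhere, and that modulo this equality it is the graph of a function.
\<close>

definition linear_operator_w ::
    "(real \<Rightarrow> real) \<Rightarrow> ((real \<Rightarrow> complex) \<times> (real \<Rightarrow> complex)) set \<Rightarrow> bool" where
  "linear_operator_w w G \<longleftrightarrow>
     G \<subseteq> L2w w \<times> L2w w \<and>
     (\<lambda>x. 0, \<lambda>x. 0) \<in> G \<and>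
     (\<forall>(f, g) \<in> G. \<forall>(f', g') \<in> G. (\<lambda>x. f x + f' x, \<lambda>x. g x + g' x) \<in> G) \<and>
     (\<forall>c. \<forall>(f, g) \<in> G. (\<lambda>x. c * f x, \<lambda>x. c * g x) \<in> G) \<and>
     (\<forall>(f, g) \<in> G. \<forall>f' \<in> L2w w. \<forall>g' \<in> L2w w. ae_eq f f' \<and> ae_eq g g' \<longrightarrow> (f', g') \<in> G) \<and>
     (\<forall>(f, g) \<in> G. \<forall>(f', g') \<in> G. ae_eq f f' \<longrightarrow> ae_eq g g')"

definition densely_defined_w ::
    "(real \<Rightarrow> real) \<Rightarrow> ((real \<Rightarrow> complex) \<times> (real \<Rightarrow> complex)) set \<Rightarrow> bool" where
  "densely_defined_w w G \<longleftrightarrow>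
     (\<forall>u \<in> L2w w. \<forall>e > 0. \<exists>f \<in> Domain G. norm_w w (\<lambda>x. f x - u x) < e)"

definition symmetric_w ::
    "(real \<Rightarrow> real) \<Rightarrow> ((real \<Rightarrow> complex) \<times> (real \<Rightarrow> complex)) set \<Rightarrow> bool" where
  "symmetric_w w G \<longleftrightarrow> (\<forall>(f, Tf) \<in> G. \<forall>(g, Tg) \<in> G. inner_w w Tf g = inner_w w f Tg)"

definition adjoint_w ::
    "(real \<Rightarrow> real) \<Rightarrow> ((real \<Rightarrow> complex) \<times> (real \<Rightarrow> complex)) set \<Rightarrow>
     ((real \<Rightarrow> complex) \<times> (real \<Rightarrow> complex)) set" where
  "adjoint_w w G =
     {(u, v). u \<in> L2w w \<and> v \<in> L2w w \<and> (\<forall>(f, Tf) \<in> G. inner_w w Tf u = inner_w w f v)}"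

definition closure_w ::
    "(real \<Rightarrow> real) \<Rightarrow> ((real \<Rightarrow> complex) \<times> (real \<Rightarrow> complex)) set \<Rightarrow>
     ((real \<Rightarrow> complex) \<times> (real \<Rightarrow> complex)) set" where
  "closure_w w G =
     {(u, v). u \<in> L2w w \<and> v \<in> L2w w \<and>
        (\<exists>F T. (\<forall>n::nat. (F n, T n) \<in> G) \<and>
               (\<lambda>n. norm_w w (\<lambda>x. F n x - u x)) \<longlonglongrightarrow> 0 \<and>
               (\<lambda>n. norm_w w (\<lambda>x. T n x - v x)) \<longlonglongrightarrow> 0)}"

definition self_adjoint_w ::
    "(real \<Rightarrow> real) \<Rightarrow> ((real \<Rightarrow> complex) \<times> (real \<Rightarrow> complex)) set \<Rightarrow> bool" where
  "self_adjoint_w w G \<longleftrightarrow> linear_operator_w w G \<and> densely_defined_w w G \<and> adjoint_w w G = G"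

definition essentially_self_adjoint_w ::
    "(real \<Rightarrow> real) \<Rightarrow> ((real \<Rightarrow> complex) \<times> (real \<Rightarrow> complex)) set \<Rightarrow> bool" where
  "essentially_self_adjoint_w w G \<longleftrightarrow>
     linear_operator_w w G \<and> densely_defined_w w G \<and> symmetric_w w G \<and>
     self_adjoint_w w (closure_w w G)"

definition operator_graph ::
    "(real \<Rightarrow> real) \<Rightarrow> (real \<Rightarrow> complex) set \<Rightarrow> ((real \<Rightarrow> complex) \<Rightarrow> (real \<Rightarrow> complex)) \<Rightarrow>
     ((real \<Rightarrow> complex) \<times> (real \<Rightarrow> complex)) set" where
  "operator_graph w D T = {(f, g). f \<in> D \<and> g \<in> L2w w \<and> ae_eq g (T f)}"


section \<open>Weak derivatives\<close>

definition test_function :: "(real \<Rightarrow> real) \<Rightarrow> bool" where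
  "test_function \<phi> \<longleftrightarrow>
     (\<forall>n x. (deriv ^^ n) \<phi> field_differentiable at x) \<and> compact (closure {x. \<phi> x \<noteq> 0})"

definition locally_integrable :: "(real \<Rightarrow> complex) \<Rightarrow> bool" where
  "locally_integrable f \<longleftrightarrow> (\<forall>a b. set_integrable lebesgue {a..b} f)"

definition has_weak_deriv :: "(real \<Rightarrow> complex) \<Rightarrow> (real \<Rightarrow> complex) \<Rightarrow> bool" where
  "has_weak_deriv f h \<longleftrightarrow>
     locally_integrable f \<and> locally_integrable h \<and>
     (\<forall>\<phi>. test_function \<phi> \<longrightarrow>
        (LINT x|lebesgue. deriv \<phi> x *\<^sub>R f x) = - (LINT x|lebesgue. \<phi> x *\<^sub>R h x))"

text \<open>
  The weak derivative is unique up to equality almost everywhere; the choice below picks one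
  representative, and is meaningful only if a weak derivative exists.
\<close>

definition weak_deriv :: "(real \<Rightarrow> complex) \<Rightarrow> (real \<Rightarrow> complex)" where
  "weak_deriv f = (SOME h. has_weak_deriv f h)"


section \<open>The operator\<close>

definition H_w :: "(real \<Rightarrow> real) \<Rightarrow> (real \<Rightarrow> complex) \<Rightarrow> (real \<Rightarrow> complex)" where
  "H_w w f = (\<lambda>x. - (\<i> / complex_of_real (w x)) * weak_deriv f x)"

text \<open>
  The limits at infinity are those of the continuous representative of the class of \<open>f\<close>, which is
  unique; for a weakly differentiable function it is the locally absolutely continuous one.
\<close>

definition D_alpha :: "(real \<Rightarrow> real) \<Rightarrow> complex \<Rightarrow> (real \<Rightarrow> complex) set" where
  "D_alpha w \<alpha> =
     {f \<in> L2w w. (\<exists>h. has_weak_deriv f h) \<and> H_w w f \<in> L2w w \<and>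
        (\<exists>F a b. continuous_on UNIV F \<and> ae_eq f F \<and>
                 (F \<longlongrightarrow> a) at_bot \<and> (F \<longlongrightarrow> b) at_top \<and> b = \<alpha> * a)}"

end

theory Submission
  imports Defs
begin

text \<open>
  The operator is self-adjoint already, so that its closure is the operator itself. The reason is
  that the weighted measure \<open>w dx\<close> is finite: in the variable given by its distribution function,
  \<open>H_w\<close> is the momentum operator \<open>- \<i> d/dy\<close> on a bounded interval, and multiplication by \<open>\<alpha>\<close> as boundary
  condition gives a self-adjoint operator because \<open>\<bar>\<alpha>\<bar> = 1\<close>. The proof carries this out without
  changing variables, by replacing the differential equation by an integral equation.

  If \<open>g = H_w f\<close> lies in the weighted space, then \<open>g * w\<close> is integrable, and \<open>f = c + \<i> * J g\<close>, where \<open>J g\<close> is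
  the primitive of \<open>g * w\<close> that vanishes at minus infinity. The limits of \<open>f\<close> are \<open>c\<close> and \<open>c + \<i> * I g\<close>, where
  \<open>I g\<close> is the integral of \<open>g * w\<close>. Conversely all such \<open>f\<close> with \<open>c + \<i> * I g = \<alpha> * c\<close> belong to the domain. This
  description of the graph (\<open>graph_iff\<close>) rests on the fact that a function with integrable weak derivative
  is a primitive of it almost everywhere, which is the lemma of du Bois-Reymond; its proof takes smooth bumps
  as test functions.

  By Fubini, \<open>(J g, v) + (g, J v) = I g * cnj (I v)\<close> (\<open>inner_cumulative\<close>). Inserting the integral equation into
  this identity shows both inclusions between the graph and its adjoint
  (\<open>graph_subset_adjoint\<close>, \<open>adjoint_subset_graph\<close>).

  As the weight may be arbitrarily small, compactly supported smooth functions need not lie in the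
  domain, and its density is a separate matter. The domain contains the trapezoids that rise and fall
  in proportion to the weighted measure of a set; these approximate indicators of half-lines, and by
  a Dynkin argument and simple functions everything else (\<open>densely_defined_graph\<close>).
\<close>

section \<open>Lebesgue measure on the line\<close>

text \<open>
  Dynkin's argument: the open half-lines are stable under intersection and generate the Borel
  sets, and every Lebesgue set agrees with a Borel set outside a null set. It serves twice, to
  show that a function whose integrals over half-lines vanish is null, and to spread
  approximability in the weighted space from half-lines to all measurable sets.
\<close>

lemma lebesgue_sets_induct [consumes 1, case_names empty lessThan compl union ae]:
  fixes P :: "real set \<Rightarrow> bool"
  assumes A: "A \<in> sets lebesgue"
    and empty: "P {}"
    and lessThan: "\<And>a. P {..<a}"
    and compl: "\<And>A. A \<in> sets lebesgue \<Longrightarrow> P A \<Longrightarrow> P (- A)"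
    and union: "\<And>A :: nat \<Rightarrow> real set. range A \<subseteq> sets lebesgue \<Longrightarrow> disjoint_family A \<Longrightarrow>
        (\<And>i. P (A i)) \<Longrightarrow> P (\<Union>i. A i)"
    and ae: "\<And>A B. A \<in> sets lebesgue \<Longrightarrow> B \<in> sets lebesgue \<Longrightarrow>
        (AE x in lebesgue. x \<in> A \<longleftrightarrow> x \<in> B) \<Longrightarrow> P A \<Longrightarrow> P B"
  shows "P A"
proof -
  have borel_sigma: "sets (borel :: real measure) = sigma_sets UNIV (range lessThan)"
    by (simp add: borel_Iio)
  have borel: "P B" if "B \<in> sets borel" for B
  proof -
    have "{..<a} \<inter> {..<b} = {..<min a b}" for a b :: real by auto
    then have stable: "Int_stable (range (lessThan :: real \<Rightarrow> real set))"
      by (auto simp: Int_stable_def)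
    have "B \<in> sigma_sets UNIV (range lessThan)"
      using that borel_sigma by simp
    from stable _ this show ?thesis
    proof (rule sigma_sets_induct_disjoint)
      fix B :: "real set" assume "B \<in> range lessThan" then show "P B" using lessThan by auto
    next
      show "P {}" by (rule empty)
    next
      fix B assume "B \<in> sigma_sets UNIV (range (lessThan :: real \<Rightarrow> real set))" "P B"
      then show "P (UNIV - B)"
        using compl[of B] borel_sigma by (simp add: Compl_eq_Diff_UNIV)
    next
      fix B :: "nat \<Rightarrow> real set"
      assume "disjoint_family B" "range B \<subseteq> sigma_sets UNIV (range (lessThan :: real \<Rightarrow> real set))"
        "\<And>i. P (B i)"
      moreover have "sigma_sets UNIV (range (lessThan :: real \<Rightarrow> real set)) \<subseteq> sets lebesgue"
        using borel_sigma by (metis sets_completionI_sets sets_lborel subsetI)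
      ultimately show "P (\<Union>i. B i)" by (intro union) auto
    qed auto
  qed
  obtain B where "B \<in> sets borel" "AE x in lebesgue. x \<in> B \<longleftrightarrow> x \<in> A"
  proof -
    obtain S N N' where "A = S \<union> N" "N \<subseteq> N'" "N' \<in> null_sets lborel" "S \<in> sets lborel"
      using A by (auto simp: sets_completion)
    moreover from this have "AE x in lebesgue. x \<notin> N'"
      by (intro AE_not_in null_sets_completionI)
    then have "AE x in lebesgue. x \<in> S \<longleftrightarrow> x \<in> A"
      by eventually_elim (use calculation in auto)
    ultimately show ?thesis using that by auto
  qed
  with borel[of B] A show ?thesis
    by (intro ae[of B A]) auto
qed

lemma sigma_finite_lebesgue: "sigma_finite_measure (lebesgue :: real measure)"
proof
  have "(\<Union>n. {- real n..real n}) = UNIV"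
    by (auto simp: abs_le_iff[symmetric]) (metis abs_le_iff minus_le_iff real_arch_simple)
  then show "\<exists>A :: real set set. countable A \<and> A \<subseteq> sets lebesgue \<and> \<Union> A = space lebesgue \<and>
      (\<forall>a\<in>A. emeasure lebesgue a \<noteq> \<infinity>)"
    by (intro exI[of _ "range (\<lambda>n. {- real n..real n})"]) auto
qed

section \<open>Smooth functions and bumps\<close>

definition smooth :: "(real \<Rightarrow> real) \<Rightarrow> bool" where
  "smooth f \<longleftrightarrow> (\<forall>n x. (deriv ^^ n) f field_differentiable at x)"

text \<open>
  Iterated derivatives are awkward to compute, so smoothness is always obtained by exhibiting a
  class of differentiable functions that is closed under \<open>deriv\<close>.
\<close>

lemma smooth_coinduct:
  assumes "f \<in> S" and step: "\<And>g. g \<in> S \<Longrightarrow> (\<forall>x. g field_differentiable at x) \<and> deriv g \<in> S"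
  shows "smooth f"
proof -
  have "(deriv ^^ n) f \<in> S" for n
    by (induction n) (use assms in auto)
  then show ?thesis
    using step by (auto simp: smooth_def)
qed

lemma smooth_deriv: "smooth f \<Longrightarrow> smooth (deriv f)"
  unfolding smooth_def by (metis comp_apply funpow_Suc_right)

lemma smooth_imp_differentiable: "smooth f \<Longrightarrow> f field_differentiable at x"
  unfolding smooth_def by (metis funpow_0)

lemma smooth_imp_DERIV: "smooth f \<Longrightarrow> (f has_real_derivative deriv f x) (at x)"
  using smooth_imp_differentiable DERIV_deriv_iff_field_differentiable by blast

lemma smooth_imp_continuous: "smooth f \<Longrightarrow> continuous_on A f"
  by (meson DERIV_isCont continuous_at_imp_continuous_on smooth_imp_DERIV)

text \<open>
  The closure of the smooth functions under the operations needed below is invariant under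
  \<open>deriv\<close> by the sum, product and chain rules, so it contains smooth functions only. This
  replaces an induction through the Leibniz formula.
\<close>

inductive_set smooth_algebra :: "(real \<Rightarrow> real) set" where
  base: "smooth f \<Longrightarrow> f \<in> smooth_algebra"
| add: "f \<in> smooth_algebra \<Longrightarrow> g \<in> smooth_algebra \<Longrightarrow> (\<lambda>x. f x + g x) \<in> smooth_algebra"
| mult: "f \<in> smooth_algebra \<Longrightarrow> g \<in> smooth_algebra \<Longrightarrow> (\<lambda>x. f x * g x) \<in> smooth_algebra"
| affine: "f \<in> smooth_algebra \<Longrightarrow> (\<lambda>x. f (a + b * x)) \<in> smooth_algebra"

lemma smooth_const: "smooth (\<lambda>x. c)"
proof (rule smooth_coinduct[of _ "range (\<lambda>c x. c)"])
  fix g :: "real \<Rightarrow> real" assume "g \<in> range (\<lambda>c x. c)"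
  then show "(\<forall>x. g field_differentiable at x) \<and> deriv g \<in> range (\<lambda>c x. c)"
    by auto
qed auto

lemma smooth_algebra_smooth: "f \<in> smooth_algebra \<Longrightarrow> smooth f"
proof (erule smooth_coinduct)
  fix g assume "g \<in> smooth_algebra"
  then have "\<exists>g' \<in> smooth_algebra. \<forall>x. (g has_real_derivative g' x) (at x)"
  proof induction
    case (base f)
    then show ?case using smooth_imp_DERIV smooth_deriv smooth_algebra.base by blast
  next
    case (add f g)
    then obtain f' g' where f': "f' \<in> smooth_algebra" "\<And>x. (f has_real_derivative f' x) (at x)"
      and g': "g' \<in> smooth_algebra" "\<And>x. (g has_real_derivative g' x) (at x)" by blast
    then have "((\<lambda>x. f x + g x) has_real_derivative f' x + g' x) (at x)" for x
      using DERIV_add by blast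
    moreover have "(\<lambda>x. f' x + g' x) \<in> smooth_algebra"
      using smooth_algebra.add[OF f'(1) g'(1)] .
    ultimately show ?case
      by (intro bexI[of _ "\<lambda>x. f' x + g' x"] allI)
  next
    case (mult f g)
    then obtain f' g' where f': "f' \<in> smooth_algebra" "\<And>x. (f has_real_derivative f' x) (at x)"
      and g': "g' \<in> smooth_algebra" "\<And>x. (g has_real_derivative g' x) (at x)" by blast
    have "((\<lambda>x. f x * g x) has_real_derivative f x * g' x + f' x * g x) (at x)" for x
      using DERIV_mult'[OF f'(2) g'(2)] .
    moreover have "(\<lambda>x. f x * g' x + f' x * g x) \<in> smooth_algebra"
      using smooth_algebra.add[OF smooth_algebra.mult[OF mult.hyps(1) g'(1)] smooth_algebra.mult[OF f'(1) mult.hyps(2)]] .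
    ultimately show ?case
      by (intro bexI[of _ "\<lambda>x. f x * g' x + f' x * g x"] allI)
  next
    case (affine f a b)
    then obtain f' where f': "f' \<in> smooth_algebra" "\<And>x. (f has_real_derivative f' x) (at x)" by blast
    have "((\<lambda>x. f (a + b * x)) has_real_derivative b * f' (a + b * x)) (at x)" for x
    proof -
      have "((\<lambda>x. a + b * x) has_real_derivative b) (at x)"
        by (auto intro!: derivative_eq_intros)
      from DERIV_chain2[OF f'(2) this] show ?thesis by (simp add: mult.commute)
    qed
    moreover have "(\<lambda>x. b * f' (a + b * x)) \<in> smooth_algebra"
      by (rule smooth_algebra.mult[OF smooth_algebra.base[OF smooth_const] smooth_algebra.affine[OF f'(1)]])
    ultimately show ?case
      by (intro bexI[of _ "\<lambda>x. b * f' (a + b * x)"] allI)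
  qed
  then obtain g' where "g' \<in> smooth_algebra" "\<And>x. (g has_real_derivative g' x) (at x)" by blast
  moreover from this have "deriv g = g'" by (auto intro: DERIV_imp_deriv)
  ultimately show "(\<forall>x. g field_differentiable at x) \<and> deriv g \<in> smooth_algebra"
    by (auto simp: field_differentiable_def)
qed

lemma smooth_add: "smooth f \<Longrightarrow> smooth g \<Longrightarrow> smooth (\<lambda>x. f x + g x)"
  using smooth_algebra_smooth[OF smooth_algebra.add[OF smooth_algebra.base smooth_algebra.base]] .

lemma smooth_mult: "smooth f \<Longrightarrow> smooth g \<Longrightarrow> smooth (\<lambda>x. f x * g x)"
  using smooth_algebra_smooth[OF smooth_algebra.mult[OF smooth_algebra.base smooth_algebra.base]] .

lemma smooth_affine: "smooth f \<Longrightarrow> smooth (\<lambda>x. f (a + b * x))"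
  using smooth_algebra_smooth[OF smooth_algebra.affine[OF smooth_algebra.base]] .

lemma smooth_antiderivative:
  assumes "smooth f" "\<And>x. (F has_real_derivative f x) (at x)"
  shows "smooth F"
proof -
  have d: "deriv F = f" using assms(2) by (auto intro: DERIV_imp_deriv)
  show ?thesis
  proof (rule smooth_coinduct[of _ "insert F (Collect smooth)"])
    fix g assume "g \<in> insert F (Collect smooth)"
    then show "(\<forall>x. g field_differentiable at x) \<and> deriv g \<in> insert F (Collect smooth)"
      using assms d smooth_imp_differentiable smooth_deriv field_differentiable_def by blast
  qed auto
qed

text \<open>
  The classical smooth function that is flat at the origin. The parameter \<open>c\<close> controls the
  steepness: as \<open>c\<close> tends to 0 the function increases to the indicator of the positive half-line.
\<close>

definition flat_exp :: "real \<Rightarrow> real \<Rightarrow> real" where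
  "flat_exp c x = (if x > 0 then exp (- c / x) else 0)"

lemma poly_times_exp_tendsto_0:
  fixes p :: "real poly" and c :: real
  assumes "c > 0"
  shows "((\<lambda>t. poly p t * exp (- c * t)) \<longlongrightarrow> 0) at_top"
proof -
  have "((\<lambda>t. \<Sum>i\<le>degree p. coeff p i * (t ^ i * exp (- c * t))) \<longlongrightarrow> 0) at_top"
  proof (intro tendsto_null_sum tendsto_mult_right_zero)
    fix i
    have "filterlim (\<lambda>t. c * t) at_top at_top"
      using assms by (simp add: filterlim_tendsto_pos_mult_at_top[OF tendsto_const] filterlim_ident)
    from filterlim_compose[OF tendsto_power_div_exp_0 this]
    have "((\<lambda>t. (c * t) ^ i / exp (c * t) / c ^ i) \<longlongrightarrow> 0 / c ^ i) at_top"
      using assms by (intro tendsto_divide) auto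
    then show "((\<lambda>t. t ^ i * exp (- c * t)) \<longlongrightarrow> 0) at_top"
      using assms by (simp add: power_mult_distrib exp_minus field_simps)
  qed
  then show ?thesis by (simp add: poly_altdef sum_distrib_right mult.assoc)
qed

text \<open>
  The functions \<open>p (1 / x) * flat_exp c x\<close> with a polynomial \<open>p\<close> form a class invariant under
  differentiation. At the origin the derivative exists because \<open>exp (- c * t)\<close> beats every
  polynomial in \<open>t = 1 / x\<close>.
\<close>

lemma flat_exp_poly_DERIV:
  fixes p :: "real poly"
  assumes c: "c > 0"
  shows "((\<lambda>x. poly p (1 / x) * flat_exp c x) has_real_derivative
            poly ([:0, 0, 1:] * (smult c p - pderiv p)) (1 / x) * flat_exp c x) (at x)"
    (is "(?f has_real_derivative ?f' x) (at x)")
proof -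
  consider "x > 0" | "x < 0" | "x = 0" by linarith
  then show ?thesis
  proof cases
    case 1
    have "((\<lambda>x. poly p (1 / x) * exp (- c / x)) has_real_derivative ?f' x) (at x)"
      using 1 by (auto intro!: derivative_eq_intros DERIV_chain'[OF _ poly_DERIV] 
          simp: flat_exp_def power2_eq_square field_simps)
    moreover have "eventually (\<lambda>y. y \<in> {0<..}) (nhds x)"
      using 1 by (intro eventually_nhds_in_open) auto
    then have "eventually (\<lambda>y. poly p (1 / y) * exp (- c / y) = ?f y) (nhds x)"
      by eventually_elim (auto simp: flat_exp_def)
    ultimately show ?thesis
      by (rule DERIV_cong_ev[OF refl _ refl, THEN iffD1, rotated])
  next
    case 2
    have "eventually (\<lambda>y. y \<in> {..<0}) (nhds x)"
      using 2 by (intro eventually_nhds_in_open) auto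
    then have "eventually (\<lambda>y. 0 = ?f y) (nhds x)"
      by eventually_elim (auto simp: flat_exp_def)
    moreover have "((\<lambda>x. 0) has_real_derivative ?f' x) (at x)"
      using 2 by (simp add: flat_exp_def)
    ultimately show ?thesis
      by (rule DERIV_cong_ev[OF refl _ refl, THEN iffD1])
  next
    case 3
    \<comment> \<open>The difference quotient at 0 is \<open>p (1 / x) / x * exp (- c / x)\<close>: one more power of \<open>1 / x\<close>.\<close>
    have inv: "filterlim (\<lambda>x. 1 / x) at_top (at_right (0::real))"
      using filterlim_inverse_at_top_right by (simp add: inverse_eq_divide)
    have "((\<lambda>x. poly (pCons 0 p) (1 / x) * exp (- c * (1 / x))) \<longlongrightarrow> 0) (at_right 0)"
      by (rule filterlim_compose[OF poly_times_exp_tendsto_0[OF c] inv])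
    moreover have "eventually (\<lambda>x. x > 0) (at_right (0::real))"
      by (simp add: eventually_at_right_less)
    then have "eventually (\<lambda>x. poly (pCons 0 p) (1 / x) * exp (- c * (1 / x)) = ?f x / x) (at_right 0)"
      by eventually_elim (auto simp: flat_exp_def field_simps)
    ultimately have "((\<lambda>x. ?f x / x) \<longlongrightarrow> 0) (at_right 0)"
      using tendsto_cong by fast
    moreover have "eventually (\<lambda>x. x < 0) (at_left (0::real))"
      by (simp add: eventually_at_left_real eventually_at_filter)
    then have "eventually (\<lambda>x. 0 = ?f x / x) (at_left 0)"
      by eventually_elim (auto simp: flat_exp_def)
    then have "((\<lambda>x. ?f x / x) \<longlongrightarrow> 0) (at_left 0)"
      by (rule tendsto_cong[THEN iffD1]) simp
    ultimately have "((\<lambda>x. ?f x / x) \<longlongrightarrow> 0) (at 0)"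
      using filterlim_split_at by blast
    then show ?thesis
      using 3 by (simp add: has_field_derivative_iff flat_exp_def)
  qed
qed

lemma smooth_flat_exp:
  assumes "c > 0"
  shows "smooth (flat_exp c)"
proof (rule smooth_coinduct)
  let ?S = "range (\<lambda>p x. poly p (1 / x) * flat_exp c x)"
  show "flat_exp c \<in> ?S"
    by (rule image_eqI[of _ _ "[:1:]"]) auto
  fix g assume "g \<in> ?S"
  then obtain p where p: "g = (\<lambda>x. poly p (1 / x) * flat_exp c x)" by auto
  have *: "(g has_real_derivative poly ([:0, 0, 1:] * (smult c p - pderiv p)) (1 / x) * flat_exp c x) (at x)"
    for x unfolding p by (rule flat_exp_poly_DERIV[OF assms])
  then have "deriv g = (\<lambda>x. poly ([:0, 0, 1:] * (smult c p - pderiv p)) (1 / x) * flat_exp c x)"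
    by (auto intro: DERIV_imp_deriv)
  then have "deriv g \<in> ?S" by (rule image_eqI) simp
  moreover have "\<forall>x. g field_differentiable at x"
    using * field_differentiable_def by blast
  ultimately show "(\<forall>x. g field_differentiable at x) \<and> deriv g \<in> ?S" by simp
qed

text \<open>
  Since the support of each bump is the fixed interval from \<open>a\<close> to \<open>b\<close> while the edges become
  steeper with \<open>n\<close>, the indicator of an open interval is a limit of test functions that are
  dominated by it.
\<close>

definition bump :: "nat \<Rightarrow> real \<Rightarrow> real \<Rightarrow> real \<Rightarrow> real" where
  "bump n a b x = flat_exp (1 / Suc n) (x - a) * flat_exp (1 / Suc n) (b - x)"

lemma bump_bounds: "0 \<le> bump n a b x" "bump n a b x \<le> 1"
  by (auto simp: bump_def flat_exp_def intro!: mult_le_one)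

lemma bump_eq_0: "x \<notin> {a<..<b} \<Longrightarrow> bump n a b x = 0"
  by (auto simp: bump_def flat_exp_def)

lemma bump_pos: "x \<in> {a<..<b} \<Longrightarrow> bump n a b x > 0"
  by (auto simp: bump_def flat_exp_def)

lemma bump_tendsto_indicator: "(\<lambda>n. bump n a b x) \<longlonglongrightarrow> indicator {a<..<b} x"
proof (cases "x \<in> {a<..<b}")
  case True
  have *: "(\<lambda>n. flat_exp (1 / Suc n) y) \<longlonglongrightarrow> 1" if "y > 0" for y
  proof -
    have "(\<lambda>n. 1 / real (Suc n)) \<longlonglongrightarrow> 0"
      using LIMSEQ_inverse_real_of_nat by (simp add: inverse_eq_divide)
    then have "(\<lambda>n. exp (- (1 / real (Suc n)) / y)) \<longlonglongrightarrow> exp (- 0 / y)"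
      using that by (intro tendsto_intros) auto
    then show ?thesis using that by (simp add: flat_exp_def)
  qed
  have "(\<lambda>n. bump n a b x) \<longlonglongrightarrow> 1 * 1"
    unfolding bump_def using True by (intro tendsto_mult *) auto
  then show ?thesis using True by simp
qed (simp add: bump_eq_0)

lemma smooth_bump: "smooth (bump n a b)"
proof -
  have "smooth (\<lambda>x. flat_exp (1 / Suc n) (- a + 1 * x) * flat_exp (1 / Suc n) (b + (- 1) * x))"
    by (intro smooth_mult smooth_affine smooth_flat_exp) auto
  then show ?thesis by (simp add: bump_def[abs_def])
qed

lemma test_function_iff:
  "test_function \<phi> \<longleftrightarrow> smooth \<phi> \<and> (\<exists>R>0. \<forall>x. \<bar>x\<bar> \<ge> R \<longrightarrow> \<phi> x = 0)"
proof -
  have "compact (closure {x. \<phi> x \<noteq> 0}) \<longleftrightarrow> bounded {x. \<phi> x \<noteq> 0}"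
    by (rule compact_closure)
  also have "\<dots> \<longleftrightarrow> (\<exists>R>0. \<forall>x. \<bar>x\<bar> \<ge> R \<longrightarrow> \<phi> x = 0)"
  proof
    assume "bounded {x. \<phi> x \<noteq> 0}"
    then obtain R where R: "R > 0" "\<And>x. \<phi> x \<noteq> 0 \<Longrightarrow> \<bar>x\<bar> < R"
      by (auto simp: bounded_pos_less)
    then have "\<forall>x. \<bar>x\<bar> \<ge> R \<longrightarrow> \<phi> x = 0"
      using linorder_not_less by blast
    with R show "\<exists>R>0. \<forall>x. \<bar>x\<bar> \<ge> R \<longrightarrow> \<phi> x = 0" by blast
  next
    assume "\<exists>R>0. \<forall>x. \<bar>x\<bar> \<ge> R \<longrightarrow> \<phi> x = 0"
    then obtain R where R: "\<And>x. \<bar>x\<bar> \<ge> R \<Longrightarrow> \<phi> x = 0" by blast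
    show "bounded {x. \<phi> x \<noteq> 0}"
      unfolding bounded_iff using R by (intro exI[of _ R]) (auto simp: not_le[symmetric] intro: ccontr)
  qed
  finally show ?thesis by (simp add: test_function_def smooth_def)
qed

lemma test_function_bump: "test_function (bump n a b)"
  unfolding test_function_iff
  by (intro conjI smooth_bump exI[of _ "\<bar>a\<bar> + \<bar>b\<bar> + 1"]) (auto intro!: bump_eq_0)

section \<open>Primitives of integrable functions\<close>

text \<open>
  The primitive that vanishes at minus infinity. For integrable \<open>p\<close> the functions
  \<open>c + primitive p\<close> are the absolutely continuous functions with derivative \<open>p\<close>.
\<close>

definition primitive :: "(real \<Rightarrow> complex) \<Rightarrow> real \<Rightarrow> complex" where
  "primitive p x = (LINT t|lebesgue. indicator {..x} t *\<^sub>R p t)"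

text \<open>
  The common source of the continuity of a primitive and of its two limits at infinity.
\<close>

lemma primitive_dominated_convergence:
  fixes S :: "real set"
  assumes p: "integrable lebesgue p" and S: "S \<in> sets lebesgue"
    and lim: "AE t in lebesgue. (\<lambda>n. indicator {..X n} t :: real) \<longlonglongrightarrow> indicator S t"
  shows "(\<lambda>n. primitive p (X n)) \<longlonglongrightarrow> (LINT t|lebesgue. indicator S t *\<^sub>R p t)"
  unfolding primitive_def
proof (rule integral_dominated_convergence)
  show "integrable lebesgue (\<lambda>t. norm (p t))" using p by simp
  show "AE t in lebesgue. (\<lambda>n. indicator {..X n} t *\<^sub>R p t) \<longlonglongrightarrow> indicator S t *\<^sub>R p t"
    using lim by eventually_elim (intro tendsto_intros)
  show "AE t in lebesgue. norm (indicator {..X n} t *\<^sub>R p t) \<le> norm (p t)" for n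
    by (auto simp: indicator_def)
qed (use p S in \<open>auto intro!: borel_measurable_scaleR borel_measurable_indicator\<close>)

lemma AE_neq_lebesgue: "AE t in lebesgue. t \<noteq> (x::real)"
  using AE_not_in[of "{x}" lebesgue] by simp

lemma continuous_primitive:
  assumes "integrable lebesgue p"
  shows "continuous_on UNIV (primitive p)"
proof -
  have "isCont (primitive p) x" for x
  proof (rule continuous_at_sequentiallyI)
    fix X assume X: "X \<longlonglongrightarrow> x"
    have "AE t in lebesgue. (\<lambda>n. indicator {..X n} t :: real) \<longlonglongrightarrow> indicator {..x} t"
      using AE_neq_lebesgue[of x]
    proof eventually_elim
      case (elim t)
      have "eventually (\<lambda>n. indicator {..X n} t = (indicator {..x} t :: real)) sequentially"
      proof (cases "t < x")
        case True
        show ?thesis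
          using order_tendstoD(1)[OF X True] by eventually_elim (use True in auto)
      next
        case False
        then have "x < t" using elim by auto
        show ?thesis
          using order_tendstoD(2)[OF X \<open>x < t\<close>] by eventually_elim (use \<open>x < t\<close> in auto)
      qed
      then show ?case by (rule tendsto_eventually)
    qed
    from primitive_dominated_convergence[OF assms _ this]
    show "(\<lambda>n. primitive p (X n)) \<longlonglongrightarrow> primitive p x"
      by (simp add: primitive_def)
  qed
  then show ?thesis by (simp add: continuous_at_imp_continuous_on)
qed

lemma measurable_primitive:
  assumes "integrable lebesgue p"
  shows "primitive p \<in> borel_measurable lebesgue"
  by (intro measurable_completion) (simp add: borel_measurable_continuous_onI continuous_primitive assms)

lemma primitive_at_bot:
  assumes "integrable lebesgue p"
  shows "(primitive p \<longlongrightarrow> 0) at_bot"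
proof (rule tendsto_at_botI_sequentially)
  fix X :: "nat \<Rightarrow> real" assume X: "filterlim X at_bot sequentially"
  have "eventually (\<lambda>n. indicator {..X n} t = (indicator {} t :: real)) sequentially" for t
  proof -
    have "eventually (\<lambda>n. X n < t) sequentially"
      using X by (simp add: filterlim_at_bot_dense)
    then show ?thesis by eventually_elim auto
  qed
  then have "AE t in lebesgue. (\<lambda>n. indicator {..X n} t :: real) \<longlonglongrightarrow> indicator {} t"
    by (intro AE_I2 tendsto_eventually)
  from primitive_dominated_convergence[OF assms _ this]
  show "(\<lambda>n. primitive p (X n)) \<longlonglongrightarrow> 0" by simp
qed

lemma primitive_at_top:
  assumes "integrable lebesgue p"
  shows "(primitive p \<longlongrightarrow> (LINT t|lebesgue. p t)) at_top"
proof (rule tendsto_at_topI_sequentially)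
  fix X :: "nat \<Rightarrow> real" assume X: "filterlim X at_top sequentially"
  have "eventually (\<lambda>n. indicator {..X n} t = (indicator UNIV t :: real)) sequentially" for t
  proof -
    have "eventually (\<lambda>n. t < X n) sequentially"
      using X by (simp add: filterlim_at_top_dense)
    then show ?thesis by eventually_elim auto
  qed
  then have "AE t in lebesgue. (\<lambda>n. indicator {..X n} t :: real) \<longlonglongrightarrow> indicator UNIV t"
    by (intro AE_I2 tendsto_eventually)
  from primitive_dominated_convergence[OF assms _ this]
  show "(\<lambda>n. primitive p (X n)) \<longlonglongrightarrow> (LINT t|lebesgue. p t)" by simp
qed

lemma norm_primitive_le:
  assumes "integrable lebesgue p"
  shows "cmod (primitive p x) \<le> (LINT t|lebesgue. cmod (p t))"
  unfolding primitive_def using assms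
  by (intro order_trans[OF integral_norm_bound] integral_mono integrable_norm integrable_mult_indicator)
    (auto simp: indicator_def)

lemma integrable_primitive_mult:
  assumes "integrable lebesgue p" "integrable lebesgue q"
  shows "integrable lebesgue (\<lambda>x. primitive p x * q x)"
proof (rule Bochner_Integration.integrable_bound)
  show "integrable lebesgue (\<lambda>x. (LINT t|lebesgue. cmod (p t)) * cmod (q x))"
    using assms by (intro integrable_mult_right integrable_norm)
  show "AE x in lebesgue. norm (primitive p x * q x) \<le> norm ((LINT t|lebesgue. cmod (p t)) * cmod (q x))"
    using norm_primitive_le[OF assms(1)] 
    by (auto simp: norm_mult abs_mult intro!: mult_right_mono order_trans[OF _ abs_ge_self])
qed (use assms measurable_primitive in \<open>auto intro!: borel_measurable_times\<close>)

lemma primitive_linear: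
  assumes "integrable lebesgue p" "integrable lebesgue q"
  shows "primitive (\<lambda>t. a * p t + b * q t) x = a * primitive p x + b * primitive q x"
proof -
  have "primitive (\<lambda>t. a * p t + b * q t) x =
      (LINT t|lebesgue. a * (indicator {..x} t *\<^sub>R p t) + b * (indicator {..x} t *\<^sub>R q t))"
    (is "_ = ?R")
    unfolding primitive_def by (intro Bochner_Integration.integral_cong) (auto simp: indicator_def)
  also have "?R = a * primitive p x + b * primitive q x"
    unfolding primitive_def
    using assms[THEN integrable_mult_indicator[of "{..x}", rotated]]
    by (simp del: mult_scaleR_right scaleR_complex.simps)
  finally show ?thesis .
qed

lemma primitive_cong_AE:
  assumes "AE t in lebesgue. p t = q t" "integrable lebesgue p" "integrable lebesgue q"
  shows "primitive p x = primitive q x"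
  unfolding primitive_def
  using assms(1) assms(2,3)[THEN borel_measurable_integrable]
  by (intro integral_cong_AE borel_measurable_scaleR borel_measurable_indicator) (auto elim: eventually_mono)

text \<open>
  Both integrals are integrals of \<open>p t * q x\<close> over a half-plane, one on each side of the diagonal,
  and the diagonal is a null set; this is Fubini. The formula is used twice, for the weak
  derivative of a primitive and for the boundary form of the operator.
\<close>

lemma primitive_by_parts:
  assumes p: "integrable lebesgue p" and q: "integrable lebesgue q"
  shows "(LINT x|lebesgue. primitive p x * q x) + (LINT x|lebesgue. p x * primitive q x) =
    (LINT x|lebesgue. p x) * (LINT x|lebesgue. q x)"
proof -
  interpret L: sigma_finite_measure "lebesgue :: real measure" by (rule sigma_finite_lebesgue)
  interpret LL: pair_sigma_finite "lebesgue :: real measure" "lebesgue :: real measure" ..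
  have [measurable]: "p \<in> borel_measurable lebesgue" "q \<in> borel_measurable lebesgue"
    using p q by auto
  \<comment> \<open>The half-plane below the diagonal, with the integration variable of \<open>q\<close> first.\<close>
  define T where "T = {z :: real \<times> real. snd z \<le> fst z}"
  have T[measurable]: "T \<in> sets (lebesgue \<Otimes>\<^sub>M lebesgue)"
  proof -
    have id: "(\<lambda>x::real. x) \<in> borel_measurable lebesgue"
      by (intro measurable_completion) simp
    have "{z \<in> space ((lebesgue :: real measure) \<Otimes>\<^sub>M (lebesgue :: real measure)). snd z \<le> fst z}
        \<in> sets (lebesgue \<Otimes>\<^sub>M lebesgue)"
      by (rule borel_measurable_le[OF measurable_compose[OF measurable_snd id]
            measurable_compose[OF measurable_fst id]])
    then show ?thesis by (simp add: T_def space_pair_measure)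
  qed
  have pq: "integrable (lebesgue \<Otimes>\<^sub>M lebesgue) (\<lambda>(x, t). p t * q x)"
  proof (rule LL.Fubini_integrable)
    show "integrable lebesgue (\<lambda>x. LINT t|lebesgue. norm (case (x, t) of (x, t) \<Rightarrow> p t * q x))"
      using p q by (simp add: norm_mult)
    show "AE x in lebesgue. integrable lebesgue (\<lambda>t. case (x, t) of (x, t) \<Rightarrow> p t * q x)"
      using p by simp
  qed measurable
  have int: "integrable (lebesgue \<Otimes>\<^sub>M lebesgue) (\<lambda>(x, t). indicator T (x, t) *\<^sub>R (p t * q x))"
    using integrable_mult_indicator[OF T pq] by (simp add: case_prod_unfold)
  have "(LINT x|lebesgue. primitive p x * q x) =
      (LINT x|lebesgue. LINT t|lebesgue. indicator T (x, t) *\<^sub>R (p t * q x))"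
  proof (rule Bochner_Integration.integral_cong[OF refl])
    fix x
    have "primitive p x * q x = (LINT t|lebesgue. (indicator {..x} t *\<^sub>R p t) * q x)"
      unfolding primitive_def by (rule integral_mult_left_zero[symmetric])
    also have "\<dots> = (LINT t|lebesgue. indicator T (x, t) *\<^sub>R (p t * q x))"
      by (intro Bochner_Integration.integral_cong) (auto simp: T_def indicator_def)
    finally show "primitive p x * q x = (LINT t|lebesgue. indicator T (x, t) *\<^sub>R (p t * q x))" .
  qed
  also have "\<dots> = (LINT t|lebesgue. LINT x|lebesgue. indicator T (x, t) *\<^sub>R (p t * q x))"
    using LL.Fubini_integral[OF int] by simp
  also have "\<dots> = (LINT t|lebesgue. p t * ((LINT x|lebesgue. q x) - primitive q t))"
  proof (rule Bochner_Integration.integral_cong[OF refl])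
    fix t
    have "(LINT x|lebesgue. indicator T (x, t) *\<^sub>R (p t * q x)) =
        (LINT x|lebesgue. p t * (q x - indicator {..t} x *\<^sub>R q x))"
    proof (rule integral_cong_AE)
      have "(\<lambda>x. indicator {t..} x *\<^sub>R (p t * q x)) \<in> borel_measurable lebesgue"
        using q by (intro borel_measurable_scaleR borel_measurable_indicator borel_measurable_times) auto
      moreover have "(\<lambda>x. indicator {t..} x *\<^sub>R (p t * q x)) = (\<lambda>x. indicator T (x, t) *\<^sub>R (p t * q x))"
        by (auto simp: T_def indicator_def)
      ultimately show "(\<lambda>x. indicator T (x, t) *\<^sub>R (p t * q x)) \<in> borel_measurable lebesgue" by simp
      show "(\<lambda>x. p t * (q x - indicator {..t} x *\<^sub>R q x)) \<in> borel_measurable lebesgue"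
        using q by (intro borel_measurable_scaleR borel_measurable_indicator borel_measurable_times
          borel_measurable_diff) auto
      show "AE x in lebesgue. indicator T (x, t) *\<^sub>R (p t * q x) = p t * (q x - indicator {..t} x *\<^sub>R q x)"
        using AE_neq_lebesgue[of t] by eventually_elim (auto simp: T_def indicator_def)
    qed
    also have "\<dots> = p t * ((LINT x|lebesgue. q x) - primitive q t)"
      using q integrable_mult_indicator[of "{..t}" lebesgue q] by (simp add: primitive_def)
    finally show "(LINT x|lebesgue. indicator T (x, t) *\<^sub>R (p t * q x)) =
        p t * ((LINT x|lebesgue. q x) - primitive q t)" .
  qed
  also have "\<dots> = (LINT t|lebesgue. p t * (LINT x|lebesgue. q x) - primitive q t * p t)"
    by (intro Bochner_Integration.integral_cong) (auto simp: algebra_simps)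
  also have "\<dots> = (LINT t|lebesgue. p t) * (LINT x|lebesgue. q x) - (LINT t|lebesgue. primitive q t * p t)"
    using p integrable_primitive_mult[OF q p] by simp
  finally show ?thesis by (simp add: mult.commute)
qed

lemma primitive_has_vector_derivative:
  assumes p: "integrable lebesgue p" and cont: "continuous_on UNIV p"
  shows "(primitive p has_vector_derivative p x) (at x)"
proof -
  have eq: "primitive p y = primitive p (x - 1) + integral {x - 1..y} p" if "y \<ge> x - 1" for y
  proof -
    \<comment> \<open>The overlap of the two intervals is one point.\<close>
    have "primitive p y = (LINT t|lebesgue. indicator {..x - 1} t *\<^sub>R p t + indicator {x - 1..y} t *\<^sub>R p t)"
      unfolding primitive_def using AE_neq_lebesgue[of "x - 1"] p that
      by (intro integral_cong_AE borel_measurable_add borel_measurable_scaleR borel_measurable_indicator)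
        (auto simp: indicator_def elim!: eventually_mono)
    also have "\<dots> = primitive p (x - 1) + (LINT t:{x - 1..y}|lebesgue. p t)"
      using p by (subst Bochner_Integration.integral_add)
        (auto simp: primitive_def set_lebesgue_integral_def intro!: integrable_mult_indicator)
    also have "(LINT t:{x - 1..y}|lebesgue. p t) = integral {x - 1..y} p"
      using p by (intro set_lebesgue_integral_eq_integral)
        (auto simp: set_integrable_def intro!: integrable_mult_indicator)
    finally show ?thesis .
  qed
  have "((\<lambda>y. integral {x - 1..y} p) has_vector_derivative p x) (at x within {x - 1..x + 1})"
    by (intro integral_has_vector_derivative continuous_on_subset[OF cont]) auto
  then have "((\<lambda>y. primitive p (x - 1) + integral {x - 1..y} p) has_vector_derivative 0 + p x) (at x)"
    by (intro has_vector_derivative_add has_vector_derivative_const)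
      (simp add: at_within_interior[of x "{x - 1..x + 1}"])
  then have "((\<lambda>y. primitive p (x - 1) + integral {x - 1..y} p) has_vector_derivative p x) (at x)"
    by simp
  then show ?thesis
  proof (rule has_vector_derivative_transform_within_open)
    fix y assume "y \<in> {x - 1<..}"
    then show "primitive p (x - 1) + integral {x - 1..y} p = primitive p y"
      by (intro eq[symmetric]) auto
  qed auto
qed

section \<open>Test functions\<close>

lemma test_function_imp_smooth: "test_function \<phi> \<Longrightarrow> smooth \<phi>"
  by (simp add: test_function_iff)

lemma test_function_deriv:
  assumes "test_function \<phi>"
  shows "test_function (deriv \<phi>)"
proof -
  obtain R where R: "R > 0" "\<And>x. \<bar>x\<bar> \<ge> R \<Longrightarrow> \<phi> x = 0"
    using assms by (auto simp: test_function_iff)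
  have "deriv \<phi> x = 0" if "\<bar>x\<bar> \<ge> R + 1" for x
  proof -
    have "open (- {- R..R})" by auto
    then have "eventually (\<lambda>y. y \<in> - {- R..R}) (nhds x)"
      using that by (intro eventually_nhds_in_open) auto
    then have "eventually (\<lambda>y. \<phi> y = 0) (nhds x)"
      by eventually_elim (auto intro!: R)
    from deriv_cong_ev[OF this refl] show ?thesis by simp
  qed
  moreover have "R + 1 > 0" using R by simp
  ultimately show ?thesis
    using assms smooth_deriv unfolding test_function_iff by blast
qed

lemma test_function_add_mult:
  assumes "test_function \<phi>" "test_function \<psi>"
  shows "test_function (\<lambda>x. \<phi> x + c * \<psi> x)"
proof -
  obtain R where R: "R > 0" "\<And>x. \<bar>x\<bar> \<ge> R \<Longrightarrow> \<phi> x = 0"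
    using assms by (auto simp: test_function_iff)
  obtain R' where R': "R' > 0" "\<And>x. \<bar>x\<bar> \<ge> R' \<Longrightarrow> \<psi> x = 0"
    using assms by (auto simp: test_function_iff)
  have "smooth (\<lambda>x. \<phi> x + c * \<psi> x)"
    using assms[THEN test_function_imp_smooth] by (intro smooth_add smooth_mult smooth_const)
  moreover have "\<forall>x. \<bar>x\<bar> \<ge> R + R' \<longrightarrow> \<phi> x + c * \<psi> x = 0"
    using R R' by auto
  ultimately show ?thesis
    using R R' unfolding test_function_iff by (intro conjI exI[of _ "R + R'"]) auto
qed

lemma locally_integrable_bounded:
  assumes "f \<in> borel_measurable lebesgue" "\<And>x. cmod (f x) \<le> B"
  shows "locally_integrable f"
  unfolding locally_integrable_def set_integrable_def
proof (intro allI)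
  fix a b :: real
  show "integrable lebesgue (\<lambda>x. indicator {a..b} x *\<^sub>R f x)"
  proof (rule Bochner_Integration.integrable_bound)
    show "integrable lebesgue (\<lambda>x. B * indicator {a..b} x)"
      by (intro integrable_mult_right integrable_real_indicator) (auto simp: emeasure_lborel_Icc_eq)
    show "AE x in lebesgue. norm (indicator {a..b} x *\<^sub>R f x) \<le> norm (B * indicator {a..b} x)"
      using assms(2) by (auto simp: indicator_def intro: order_trans[OF _ abs_ge_self])
  qed (use assms in \<open>auto intro!: borel_measurable_scaleR borel_measurable_indicator\<close>)
qed

lemma locally_integrable_const: "locally_integrable (\<lambda>x. c)"
  by (rule locally_integrable_bounded[of _ "cmod c"]) auto

lemma integrable_imp_locally_integrable: "integrable lebesgue f \<Longrightarrow> locally_integrable f"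
  by (auto simp: locally_integrable_def set_integrable_def intro!: integrable_mult_indicator)

lemma locally_integrable_diff:
  "locally_integrable f \<Longrightarrow> locally_integrable g \<Longrightarrow> locally_integrable (\<lambda>x. f x - g x)"
  unfolding locally_integrable_def set_integrable_def
  by (simp add: scaleR_diff_right del: scaleR_complex.simps)

lemma integrable_test_function_scaleR:
  assumes \<phi>: "test_function \<phi>" and f: "locally_integrable f"
  shows "integrable lebesgue (\<lambda>x. \<phi> x *\<^sub>R f x)"
proof -
  obtain R where R: "R > 0" "\<And>x. \<bar>x\<bar> \<ge> R \<Longrightarrow> \<phi> x = 0"
    using \<phi> by (auto simp: test_function_iff)
  have cont: "continuous_on S \<phi>" for S
    using \<phi> by (intro smooth_imp_continuous test_function_imp_smooth)
  have "bounded (\<phi> ` {- R..R})"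
    by (intro compact_imp_bounded compact_continuous_image cont) auto
  then obtain C where "\<forall>x\<in>{- R..R}. \<bar>\<phi> x\<bar> \<le> C"
    by (auto simp: bounded_iff)
  then have C: "\<bar>\<phi> x\<bar> \<le> C" if "x \<in> {- R..R}" for x
    using that by blast
  have eq: "\<phi> x *\<^sub>R f x = \<phi> x *\<^sub>R (indicator {- R..R} x *\<^sub>R f x)" for x
    using R(2)[of x] by (cases "x \<in> {- R..R}") auto
  have loc: "integrable lebesgue (\<lambda>x. indicator {- R..R} x *\<^sub>R f x)"
    using f by (auto simp: locally_integrable_def set_integrable_def)
  show ?thesis
  proof (rule Bochner_Integration.integrable_bound)
    show "integrable lebesgue (\<lambda>x. C * norm (indicator {- R..R} x *\<^sub>R f x))"
      by (intro integrable_mult_right integrable_norm loc)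
    have "\<phi> \<in> borel_measurable lebesgue"
      by (intro measurable_completion) (simp add: borel_measurable_continuous_onI cont)
    then show "(\<lambda>x. \<phi> x *\<^sub>R f x) \<in> borel_measurable lebesgue"
      unfolding eq by (intro borel_measurable_scaleR borel_measurable_integrable[OF loc])
    show "AE x in lebesgue. norm (\<phi> x *\<^sub>R f x) \<le> norm (C * norm (indicator {- R..R} x *\<^sub>R f x))"
    proof (intro AE_I2)
      fix x :: real
      show "norm (\<phi> x *\<^sub>R f x) \<le> norm (C * norm (indicator {- R..R} x *\<^sub>R f x))"
      proof (cases "x \<in> {- R..R}")
        case True
        then have "\<bar>\<phi> x\<bar> * cmod (f x) \<le> \<bar>C\<bar> * cmod (f x)"
          using C[OF True] by (intro mult_right_mono) auto
        then show ?thesis using True by (simp add: abs_mult)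
      next
        case False
        then have "\<phi> x = 0" by (intro R) auto
        then show ?thesis by simp
      qed
    qed
  qed
qed

lemma integrable_test_function:
  assumes "test_function \<phi>"
  shows "integrable lebesgue (\<lambda>x. complex_of_real (\<phi> x))"
  using integrable_test_function_scaleR[OF assms locally_integrable_const[of 1]]
  by (simp add: scaleR_conv_of_real)

text \<open>
  Both sides have the same derivative and vanish near minus infinity; the second claim is the
  value at plus infinity.
\<close>

lemma primitive_deriv_test_function:
  assumes \<phi>: "test_function \<phi>"
  shows "primitive (\<lambda>x. complex_of_real (deriv \<phi> x)) x = complex_of_real (\<phi> x)" (is "primitive ?p x = _")
    and "(LINT x|lebesgue. complex_of_real (deriv \<phi> x)) = 0"
proof -
  obtain R where R: "R > 0" "\<And>x. \<bar>x\<bar> \<ge> R \<Longrightarrow> \<phi> x = 0"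
    using \<phi> by (auto simp: test_function_iff)
  have int: "integrable lebesgue ?p"
    by (intro integrable_test_function test_function_deriv \<phi>)
  have "continuous_on UNIV (deriv \<phi>)"
    by (intro smooth_imp_continuous smooth_deriv test_function_imp_smooth \<phi>)
  then have cont: "continuous_on UNIV ?p" by (intro continuous_intros)
  have "((\<lambda>x. primitive ?p x - complex_of_real (\<phi> x)) has_vector_derivative ?p x - ?p x) (at x)" for x
  proof (intro has_vector_derivative_diff primitive_has_vector_derivative int cont)
    have "(\<phi> has_vector_derivative deriv \<phi> x) (at x)"
      using smooth_imp_DERIV[OF test_function_imp_smooth[OF \<phi>]]
      by (simp add: has_real_derivative_iff_has_vector_derivative)
    then show "((\<lambda>x. complex_of_real (\<phi> x)) has_vector_derivative ?p x) (at x)"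
      by (rule bounded_linear.has_vector_derivative[OF bounded_linear_of_real])
  qed
  then have "\<exists>c. \<forall>x\<in>UNIV. primitive ?p x - complex_of_real (\<phi> x) = c"
    by (intro has_derivative_zero_constant) (auto simp: has_vector_derivative_def)
  then obtain c where c: "\<And>x. primitive ?p x = c + complex_of_real (\<phi> x)"
    by (auto simp: algebra_simps)
  have "eventually (\<lambda>x. primitive ?p x = c) at_bot"
    using eventually_le_at_bot[of "- R"] by eventually_elim (use R c in auto)
  then have "(primitive ?p \<longlongrightarrow> c) at_bot" by (rule tendsto_eventually)
  then have "c = 0"
    using primitive_at_bot[OF int] tendsto_unique[OF trivial_limit_at_bot_linorder] by blast
  with c show *: "primitive ?p x = complex_of_real (\<phi> x)" for x by simp
  have "eventually (\<lambda>x. primitive ?p x = 0) at_top"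
    using eventually_ge_at_top[of R] by eventually_elim (use R * in auto)
  then have "(primitive ?p \<longlongrightarrow> 0) at_top" by (rule tendsto_eventually)
  then show "(LINT x|lebesgue. ?p x) = 0"
    using primitive_at_top[OF int] tendsto_unique[OF trivial_limit_at_top_linorder] by blast
qed

text \<open>
  The vanishing integral is what makes the primitive vanish to the right of the support.
\<close>

lemma test_function_antiderivative:
  assumes \<psi>: "test_function \<psi>" and zero: "(LINT x|lebesgue. complex_of_real (\<psi> x)) = 0"
  obtains \<phi> where "test_function \<phi>" "deriv \<phi> = \<psi>"
proof -
  obtain R where R: "R > 0" "\<And>x. \<bar>x\<bar> \<ge> R \<Longrightarrow> \<psi> x = 0"
    using \<psi> by (auto simp: test_function_iff)
  let ?p = "\<lambda>x. complex_of_real (\<psi> x)"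
  define \<phi> where "\<phi> x = Re (primitive ?p x)" for x
  have int: "integrable lebesgue ?p" by (intro integrable_test_function \<psi>)
  have cont: "continuous_on UNIV ?p"
    by (intro continuous_intros smooth_imp_continuous test_function_imp_smooth \<psi>)
  have "(\<phi> has_vector_derivative Re (?p x)) (at x)" for x
    unfolding \<phi>_def[abs_def]
    by (rule bounded_linear.has_vector_derivative[OF bounded_linear_Re])
      (intro primitive_has_vector_derivative int cont)
  then have D: "(\<phi> has_real_derivative \<psi> x) (at x)" for x
    by (simp add: has_real_derivative_iff_has_vector_derivative)
  have "primitive ?p x = 0" if "\<bar>x\<bar> \<ge> R" for x
  proof (cases "x \<ge> R")
    case True
    have "primitive ?p x = (LINT x|lebesgue. ?p x)"
      unfolding primitive_def using True R
      by (intro Bochner_Integration.integral_cong) (auto simp: indicator_def)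
    then show ?thesis using zero by simp
  next
    case False
    then have "primitive ?p x = (LINT x|(lebesgue :: real measure). 0)"
      unfolding primitive_def using that R
      by (intro Bochner_Integration.integral_cong) (auto simp: indicator_def)
    then show ?thesis by simp
  qed
  then have "\<forall>x. \<bar>x\<bar> \<ge> R \<longrightarrow> \<phi> x = 0" by (simp add: \<phi>_def)
  moreover have "smooth \<phi>"
    using smooth_antiderivative[OF test_function_imp_smooth[OF \<psi>] D] .
  ultimately have "test_function \<phi>"
    using R(1) unfolding test_function_iff by blast
  moreover have "deriv \<phi> = \<psi>" using D by (auto intro: DERIV_imp_deriv)
  ultimately show ?thesis using that by blast
qed

section \<open>Weak derivatives\<close>

text \<open>
  Integration by parts against \<open>deriv \<phi>\<close>, whose primitive is \<open>\<phi>\<close> and whose integral is 0, so that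
  neither the constant nor a boundary term contributes.
\<close>

lemma has_weak_deriv_primitive:
  assumes h: "integrable lebesgue h"
  shows "has_weak_deriv (\<lambda>x. c + primitive h x) h"
  unfolding has_weak_deriv_def
proof (intro conjI allI impI)
  show "locally_integrable h" by (rule integrable_imp_locally_integrable[OF h])
  show "locally_integrable (\<lambda>x. c + primitive h x)"
  proof (rule locally_integrable_bounded)
    show "(\<lambda>x. c + primitive h x) \<in> borel_measurable lebesgue"
      using measurable_primitive[OF h] by auto
    show "cmod (c + primitive h x) \<le> cmod c + (LINT t|lebesgue. cmod (h t))" for x
      using norm_primitive_le[OF h] norm_triangle_ineq[of c "primitive h x"] by (meson add_left_mono order_trans)
  qed
  fix \<phi> assume \<phi>: "test_function \<phi>"
  let ?p = "\<lambda>x. complex_of_real (deriv \<phi> x)"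
  have p: "integrable lebesgue ?p"
    by (intro integrable_test_function test_function_deriv \<phi>)
  have "(LINT x|lebesgue. deriv \<phi> x *\<^sub>R (c + primitive h x)) = (LINT x|lebesgue. c * ?p x + primitive h x * ?p x)"
    by (intro Bochner_Integration.integral_cong) (auto simp: scaleR_conv_of_real algebra_simps)
  also have "\<dots> = c * (LINT x|lebesgue. ?p x) + (LINT x|lebesgue. primitive h x * ?p x)"
    using p integrable_primitive_mult[OF h p] by simp
  also have "\<dots> = (LINT x|lebesgue. primitive h x * ?p x)"
    using primitive_deriv_test_function(2)[OF \<phi>] by simp
  also have "\<dots> = - (LINT x|lebesgue. h x * primitive ?p x)"
    using primitive_by_parts[OF h p] primitive_deriv_test_function(2)[OF \<phi>]
    by (simp add: eq_neg_iff_add_eq_0)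
  also have "\<dots> = - (LINT x|lebesgue. \<phi> x *\<^sub>R h x)"
    using primitive_deriv_test_function(1)[OF \<phi>] by (simp add: scaleR_conv_of_real mult.commute)
  finally show "(LINT x|lebesgue. deriv \<phi> x *\<^sub>R (c + primitive h x)) = - (LINT x|lebesgue. \<phi> x *\<^sub>R h x)" .
qed

lemma AE_zero_if_integral_lessThan_zero:
  fixes h :: "real \<Rightarrow> complex"
  assumes h: "integrable lebesgue h"
    and zero: "\<And>a. (LINT x|lebesgue. indicator {..<a} x *\<^sub>R h x) = 0"
    and total: "(LINT x|lebesgue. h x) = 0"
  shows "AE x in lebesgue. h x = 0"
proof -
  interpret sigma_finite_measure "lebesgue :: real measure" by (rule sigma_finite_lebesgue)
  have "(LINT x:A|lebesgue. h x) = 0" if "A \<in> sets lebesgue" for A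
    using that
  proof (induction rule: lebesgue_sets_induct)
    case empty
    show ?case by (simp add: set_lebesgue_integral_def)
  next
    case (lessThan a)
    then show ?case using zero by (simp add: set_lebesgue_integral_def)
  next
    case (compl A)
    have "(LINT x:- A|lebesgue. h x) = (LINT x|lebesgue. h x - indicator A x *\<^sub>R h x)"
      unfolding set_lebesgue_integral_def
      by (intro Bochner_Integration.integral_cong) (auto simp: indicator_def)
    also have "\<dots> = 0"
      using h compl total integrable_mult_indicator[OF compl(1) h]
      by (simp add: set_lebesgue_integral_def)
    finally show ?case .
  next
    case (union A)
    have "set_integrable lebesgue (\<Union>i. A i) h"
      using union(1) h by (auto simp: set_integrable_def intro!: integrable_mult_indicator)
    from lebesgue_integral_countable_add[OF _ _ this] union
    have "(LINT x:(\<Union>i. A i)|lebesgue. h x) = (\<Sum>i. (LINT x:A i|lebesgue. h x))"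
      by (auto simp: disjoint_family_on_def)
    then show ?case using union by simp
  next
    case (ae A B)
    have "(LINT x:B|lebesgue. h x) = (LINT x:A|lebesgue. h x)"
      unfolding set_lebesgue_integral_def using ae h
      by (intro integral_cong_AE borel_measurable_scaleR borel_measurable_indicator)
        (auto simp: indicator_def elim!: eventually_mono)
    then show ?case using ae by simp
  qed
  then show ?thesis by (rule density_zero[OF h])
qed

text \<open>
  The fundamental lemma of the calculus of variations. Letting bumps increase to the indicator of
  a bounded interval shows that \<open>h\<close> has integral 0 over every such interval; truncation to
  intervals around the origin reduces to integrable \<open>h\<close>.
\<close>

lemma AE_zero_if_orthogonal_to_test_functions:
  assumes h: "locally_integrable h"
    and zero: "\<And>\<phi>. test_function \<phi> \<Longrightarrow> (LINT x|lebesgue. \<phi> x *\<^sub>R h x) = 0"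
  shows "AE x in lebesgue. h x = 0"
proof -
  have interval: "(LINT x|lebesgue. indicator {a<..<b} x *\<^sub>R h x) = 0" for a b
  proof -
    have "integrable lebesgue (\<lambda>x. indicator {a..b} x *\<^sub>R h x)"
      using h by (auto simp: locally_integrable_def set_integrable_def)
    from integrable_mult_indicator[OF _ this, of "{a<..<b}"]
    have ab: "integrable lebesgue (\<lambda>x. indicator {a<..<b} x *\<^sub>R h x)"
      by (rule Bochner_Integration.integrable_cong[THEN iffD1, OF refl, rotated]) (auto simp: indicator_def)
    have "(\<lambda>n. LINT x|lebesgue. bump n a b x *\<^sub>R h x) \<longlonglongrightarrow> (LINT x|lebesgue. indicator {a<..<b} x *\<^sub>R h x)"
    proof (rule integral_dominated_convergence)
      show "integrable lebesgue (\<lambda>x. norm (indicator {a<..<b} x *\<^sub>R h x))"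
        using ab by (rule integrable_norm)
      show "AE x in lebesgue. (\<lambda>n. bump n a b x *\<^sub>R h x) \<longlonglongrightarrow> indicator {a<..<b} x *\<^sub>R h x"
        by (intro AE_I2 tendsto_scaleR bump_tendsto_indicator tendsto_const)
      show "AE x in lebesgue. norm (bump n a b x *\<^sub>R h x) \<le> norm (indicator {a<..<b} x *\<^sub>R h x)" for n
      proof (intro AE_I2)
        fix x
        show "norm (bump n a b x *\<^sub>R h x) \<le> norm (indicator {a<..<b} x *\<^sub>R h x)"
          using bump_bounds[of n a b x] bump_eq_0[of x a b n]
          by (cases "x \<in> {a<..<b}") (auto intro: mult_left_le_one_le)
      qed
      show "(\<lambda>x. bump n a b x *\<^sub>R h x) \<in> borel_measurable lebesgue" for n
        using integrable_test_function_scaleR[OF test_function_bump h] by auto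
    qed (use ab in auto)
    moreover have "(LINT x|lebesgue. bump n a b x *\<^sub>R h x) = 0" for n
      by (intro zero test_function_bump)
    ultimately show ?thesis by (simp add: LIMSEQ_const_iff)
  qed
  have "AE x in lebesgue. indicator {- real N<..<real N} x *\<^sub>R h x = 0" for N
  proof (rule AE_zero_if_integral_lessThan_zero)
    let ?h = "\<lambda>x. indicator {- real N<..<real N} x *\<^sub>R h x"
    have "integrable lebesgue (\<lambda>x. indicator {- real N..real N} x *\<^sub>R h x)"
      using h by (auto simp: locally_integrable_def set_integrable_def)
    from integrable_mult_indicator[OF _ this, of "{- real N<..<real N}"]
    show "integrable lebesgue ?h"
      by (rule Bochner_Integration.integrable_cong[THEN iffD1, OF refl, rotated]) (auto simp: indicator_def)
    show "(LINT x|lebesgue. ?h x) = 0" by (rule interval)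
    show "(LINT x|lebesgue. indicator {..<a} x *\<^sub>R ?h x) = 0" for a
    proof -
      have "(LINT x|lebesgue. indicator {..<a} x *\<^sub>R ?h x)
          = (LINT x|lebesgue. indicator {- real N<..<min a (real N)} x *\<^sub>R h x)"
        by (intro Bochner_Integration.integral_cong) (auto simp: indicator_def)
      then show ?thesis using interval by simp
    qed
  qed
  then have "AE x in lebesgue. \<forall>N. indicator {- real N<..<real N} x *\<^sub>R h x = 0"
    unfolding AE_all_countable by blast
  then show ?thesis
  proof eventually_elim
    case (elim x)
    obtain N where "\<bar>x\<bar> < real N" using reals_Archimedean2 by blast
    with elim show ?case by (auto simp: indicator_def dest!: spec[of _ N])
  qed
qed

text \<open>
  Du Bois-Reymond's argument. A test function is a derivative of a test function as soon as its
  integral is 0, and any \<open>\<psi>\<close> can be corrected to this by a multiple of one fixed bump. Hence \<open>u\<close> acts on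
  test functions as a constant times the integral, and \<open>u\<close> minus that constant is orthogonal to
  all test functions.
\<close>

lemma weak_deriv_zero_imp_const:
  assumes u: "locally_integrable u"
    and zero: "\<And>\<phi>. test_function \<phi> \<Longrightarrow> (LINT x|lebesgue. deriv \<phi> x *\<^sub>R u x) = 0"
  obtains c where "AE x in lebesgue. u x = c"
proof -
  define I where "I \<psi> = (LINT x|lebesgue. complex_of_real (\<psi> x))" for \<psi> :: "real \<Rightarrow> real"
  let ?b = "bump 0 0 1"
  have b: "test_function ?b" by (rule test_function_bump)
  have I_real: "I \<psi> = complex_of_real (LINT x|lebesgue. \<psi> x)" for \<psi>
    by (simp add: I_def)
  have "(LINT x|lebesgue. ?b x) \<noteq> 0"
  proof
    assume "(LINT x|lebesgue. ?b x) = 0"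
    moreover have "integrable lebesgue ?b"
      using integrable_Re[OF integrable_test_function[OF b]] by simp
    ultimately have "AE x in lebesgue. ?b x = 0"
      using integral_nonneg_eq_0_iff_AE[of lebesgue ?b] bump_bounds(1) by auto
    then have "AE x in lebesgue. x \<notin> {0<..<1::real}"
      by eventually_elim (use bump_pos[of _ 0 1 0] in force)
    then have "{0<..<1::real} \<in> null_sets lebesgue"
      by (subst AE_iff_null_sets) auto
    then have "emeasure lebesgue {0<..<1::real} = 0" by (rule null_setsD1)
    then show False by simp
  qed
  then have Ib: "I ?b \<noteq> 0" by (simp add: I_real)
  \<comment> \<open>The average of \<open>u\<close> with respect to the bump; it must be the value of the constant.\<close>
  define c where "c = (LINT x|lebesgue. ?b x *\<^sub>R u x) / I ?b"
  have "AE x in lebesgue. u x - c = 0"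
  proof (rule AE_zero_if_orthogonal_to_test_functions)
    show "locally_integrable (\<lambda>x. u x - c)"
      by (intro locally_integrable_diff locally_integrable_const u)
    fix \<psi> assume \<psi>: "test_function \<psi>"
    define k where "k = - (LINT x|lebesgue. \<psi> x) / (LINT x|lebesgue. ?b x)"
    have k: "complex_of_real k = - I \<psi> / I ?b" by (simp add: I_real k_def)
    let ?\<chi> = "\<lambda>x. \<psi> x + k * ?b x"
    have \<chi>: "test_function ?\<chi>" by (rule test_function_add_mult[OF \<psi> b])
    have "(LINT x|lebesgue. complex_of_real (?\<chi> x)) = I \<psi> + k * I ?b"
      using integrable_test_function[OF \<psi>] integrable_test_function[OF b]
      by (simp add: I_def)
    also have "\<dots> = 0" using Ib by (simp add: k)
    finally obtain \<phi> where "test_function \<phi>" "deriv \<phi> = ?\<chi>"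
      using test_function_antiderivative[OF \<chi>] by blast
    with zero[of \<phi>] have "0 = (LINT x|lebesgue. ?\<chi> x *\<^sub>R u x)" by simp
    also have "\<dots> = (LINT x|lebesgue. \<psi> x *\<^sub>R u x + k *\<^sub>R (?b x *\<^sub>R u x))"
      by (intro Bochner_Integration.integral_cong) (auto simp: scaleR_add_left)
    also have "\<dots> = (LINT x|lebesgue. \<psi> x *\<^sub>R u x) + k *\<^sub>R (LINT x|lebesgue. ?b x *\<^sub>R u x)"
      using integrable_test_function_scaleR[OF \<psi> u] integrable_test_function_scaleR[OF b u]
      by (subst Bochner_Integration.integral_add) (auto simp del: scaleR_scaleR)
    also have "k *\<^sub>R (LINT x|lebesgue. ?b x *\<^sub>R u x) = - (I \<psi> * c)"
      by (simp add: scaleR_conv_of_real[of k] k c_def)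
    finally have *: "(LINT x|lebesgue. \<psi> x *\<^sub>R u x) = I \<psi> * c" by simp
    have "(LINT x|lebesgue. \<psi> x *\<^sub>R (u x - c)) = (LINT x|lebesgue. \<psi> x *\<^sub>R u x - complex_of_real (\<psi> x) * c)"
      by (intro Bochner_Integration.integral_cong) (auto simp: scaleR_conv_of_real algebra_simps)
    also have "\<dots> = (LINT x|lebesgue. \<psi> x *\<^sub>R u x) - I \<psi> * c"
      using integrable_test_function_scaleR[OF \<psi> u] integrable_test_function[OF \<psi>]
      unfolding I_def by (subst Bochner_Integration.integral_diff) auto
    finally show "(LINT x|lebesgue. \<psi> x *\<^sub>R (u x - c)) = 0" using * by simp
  qed
  then show ?thesis using that[of c] by simp
qed

lemma has_weak_deriv_unique:
  assumes "has_weak_deriv f g" "has_weak_deriv f h"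
  shows "AE x in lebesgue. g x = h x"
proof -
  have g: "locally_integrable g" and h: "locally_integrable h"
    using assms by (auto simp: has_weak_deriv_def)
  have "AE x in lebesgue. g x - h x = 0"
  proof (rule AE_zero_if_orthogonal_to_test_functions[OF locally_integrable_diff[OF g h]])
    fix \<phi> assume \<phi>: "test_function \<phi>"
    have "(LINT x|lebesgue. \<phi> x *\<^sub>R (g x - h x)) = (LINT x|lebesgue. \<phi> x *\<^sub>R g x - \<phi> x *\<^sub>R h x)"
      by (simp only: scaleR_diff_right)
    also have "\<dots> = (LINT x|lebesgue. \<phi> x *\<^sub>R g x) - (LINT x|lebesgue. \<phi> x *\<^sub>R h x)"
      using integrable_test_function_scaleR[OF \<phi>] g h by (intro Bochner_Integration.integral_diff)
    also have "\<dots> = 0"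
    proof -
      have "(LINT x|lebesgue. deriv \<phi> x *\<^sub>R f x) = - (LINT x|lebesgue. \<phi> x *\<^sub>R g x)"
        "(LINT x|lebesgue. deriv \<phi> x *\<^sub>R f x) = - (LINT x|lebesgue. \<phi> x *\<^sub>R h x)"
        using assms \<phi> by (auto simp: has_weak_deriv_def)
      then show ?thesis by simp
    qed
    finally show "(LINT x|lebesgue. \<phi> x *\<^sub>R (g x - h x)) = 0" .
  qed
  then show ?thesis by simp
qed

lemma locally_integrable_measurable:
  assumes "locally_integrable f"
  shows "f \<in> borel_measurable lebesgue"
proof (rule borel_measurable_LIMSEQ_metric)
  show "(\<lambda>x. indicator {- real n..real n} x *\<^sub>R f x) \<in> borel_measurable lebesgue" for n
    using assms unfolding locally_integrable_def set_integrable_def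
    by (intro borel_measurable_integrable) blast
  show "(\<lambda>n. indicator {- real n..real n} x *\<^sub>R f x) \<longlonglongrightarrow> f x" for x
  proof (rule tendsto_eventually)
    obtain N where "\<bar>x\<bar> < real N" using reals_Archimedean2 by blast
    then show "eventually (\<lambda>n. indicator {- real n..real n} x *\<^sub>R f x = f x) sequentially"
      by (intro eventually_sequentiallyI[of N]) (auto simp: indicator_def)
  qed
qed

lemma has_weak_deriv_cong_AE:
  assumes "AE x in lebesgue. f x = g x" "f \<in> borel_measurable lebesgue" "g \<in> borel_measurable lebesgue"
  shows "has_weak_deriv f h \<longleftrightarrow> has_weak_deriv g h"
proof -
  have "(LINT x|lebesgue. r x *\<^sub>R f x) = (LINT x|lebesgue. r x *\<^sub>R g x)"
    if "r \<in> borel_measurable lebesgue" for r :: "real \<Rightarrow> real"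
    using assms that by (intro integral_cong_AE borel_measurable_scaleR) (auto elim: eventually_mono)
  moreover have "deriv \<phi> \<in> borel_measurable lebesgue" if "test_function \<phi>" for \<phi>
    using that by (intro measurable_completion)
      (simp add: borel_measurable_continuous_onI smooth_imp_continuous smooth_deriv test_function_imp_smooth)
  moreover have "locally_integrable f \<longleftrightarrow> locally_integrable g"
    unfolding locally_integrable_def set_integrable_def using assms
    by (intro all_cong1 integrable_cong_AE borel_measurable_scaleR borel_measurable_indicator)
      (auto elim: eventually_mono)
  ultimately show ?thesis unfolding has_weak_deriv_def by auto
qed

text \<open>
  The function and the primitive of its weak derivative differ by a function with weak derivative
  zero.
\<close>

lemma has_integrable_weak_deriv_imp_primitive:
  assumes f: "has_weak_deriv f h" and h: "integrable lebesgue h"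
  obtains c where "AE x in lebesgue. f x = c + primitive h x"
proof -
  have P: "has_weak_deriv (\<lambda>x. 0 + primitive h x) h" by (rule has_weak_deriv_primitive[OF h])
  then have loc: "locally_integrable f" "locally_integrable (primitive h)"
    using f by (auto simp: has_weak_deriv_def)
  obtain c where c: "AE x in lebesgue. f x - primitive h x = c"
  proof (rule weak_deriv_zero_imp_const[OF locally_integrable_diff[OF loc]])
    fix \<phi> assume \<phi>: "test_function \<phi>"
    have "(LINT x|lebesgue. deriv \<phi> x *\<^sub>R (f x - primitive h x)) =
        (LINT x|lebesgue. deriv \<phi> x *\<^sub>R f x - deriv \<phi> x *\<^sub>R primitive h x)"
      by (simp only: scaleR_diff_right)
    also have "\<dots> = (LINT x|lebesgue. deriv \<phi> x *\<^sub>R f x) - (LINT x|lebesgue. deriv \<phi> x *\<^sub>R primitive h x)"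
      using integrable_test_function_scaleR[OF test_function_deriv[OF \<phi>]] loc
      by (intro Bochner_Integration.integral_diff)
    also have "\<dots> = 0"
      using f P \<phi> unfolding has_weak_deriv_def by simp
    finally show "(LINT x|lebesgue. deriv \<phi> x *\<^sub>R (f x - primitive h x)) = 0" .
  qed blast
  then have "AE x in lebesgue. f x = c + primitive h x"
    by eventually_elim (auto simp: algebra_simps)
  then show ?thesis by (rule that)
qed

section \<open>The weighted space\<close>

text \<open>
  In other words, the weighted measure is finite and has the same null sets as Lebesgue measure.
\<close>

locale integrable_weight =
  fixes w :: "real \<Rightarrow> real"
  assumes AE_pos: "AE x in lebesgue. 0 < w x"
    and integrable_weight: "integrable lebesgue w"
begin

lemma measurable_weight [measurable]: "w \<in> borel_measurable lebesgue"
  using integrable_weight by simp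

lemma L2w_measurable [measurable_dest]: "f \<in> L2w w \<Longrightarrow> f \<in> borel_measurable lebesgue"
  by (simp add: L2w_def)

lemma measurable_inner:
  assumes "f \<in> borel_measurable lebesgue" "g \<in> borel_measurable lebesgue"
  shows "(\<lambda>x. f x * cnj (g x) * complex_of_real (w x)) \<in> borel_measurable lebesgue"
proof -
  have "(\<lambda>x. cnj (g x)) \<in> borel_measurable lebesgue"
    by (rule measurable_compose[OF assms(2)]) (intro borel_measurable_continuous_onI continuous_intros)
  moreover have "(\<lambda>x. complex_of_real (w x)) \<in> borel_measurable lebesgue"
    by (rule measurable_compose[OF measurable_weight]) (intro borel_measurable_continuous_onI continuous_intros)
  ultimately show ?thesis using assms by (intro borel_measurable_times)
qed

lemma L2w_integrable_square: "f \<in> L2w w \<Longrightarrow> integrable lebesgue (\<lambda>x. (cmod (f x))\<^sup>2 * w x)"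
  by (simp add: L2w_def)

text \<open>
  The majorant \<open>b\<close> bounds the squared modulus, so that sums and bounded functions are covered alike.
\<close>

lemma L2w_dominated:
  assumes "f \<in> borel_measurable lebesgue" "integrable lebesgue (\<lambda>x. b x * w x)"
    and "AE x in lebesgue. (cmod (f x))\<^sup>2 \<le> b x"
  shows "f \<in> L2w w"
proof -
  have "integrable lebesgue (\<lambda>x. (cmod (f x))\<^sup>2 * w x)"
  proof (rule Bochner_Integration.integrable_bound[OF assms(2)])
    show "AE x in lebesgue. norm ((cmod (f x))\<^sup>2 * w x) \<le> norm (b x * w x)"
      using assms(3) AE_pos
    proof eventually_elim
      case (elim x)
      then have "(cmod (f x))\<^sup>2 * w x \<le> b x * w x" by (intro mult_right_mono) auto
      moreover have "0 \<le> (cmod (f x))\<^sup>2 * w x" using elim by simp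
      ultimately show ?case by simp
    qed
  qed (use assms(1) in measurable)
  then show ?thesis using assms(1) by (simp add: L2w_def)
qed

lemma L2w_bounded:
  assumes "f \<in> borel_measurable lebesgue" "\<And>x. cmod (f x) \<le> B"
  shows "f \<in> L2w w"
proof (rule L2w_dominated[OF assms(1)])
  show "integrable lebesgue (\<lambda>x. B\<^sup>2 * w x)" using integrable_weight by simp
  show "AE x in lebesgue. (cmod (f x))\<^sup>2 \<le> B\<^sup>2" using assms(2) by (intro AE_I2 power_mono) auto
qed

lemma L2w_const: "(\<lambda>x. c) \<in> L2w w"
  by (rule L2w_bounded[of _ "cmod c"]) auto

lemma cmod_add_square_le: "(cmod (a + b))\<^sup>2 \<le> 2 * (cmod a)\<^sup>2 + 2 * (cmod b)\<^sup>2"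
proof -
  have "(cmod (a + b))\<^sup>2 \<le> (cmod a + cmod b)\<^sup>2" by (intro power_mono norm_triangle_ineq) auto
  moreover have "0 \<le> (cmod a - cmod b)\<^sup>2" by simp
  ultimately show ?thesis by (simp add: power2_eq_square algebra_simps)
qed

lemma L2w_add:
  assumes "f \<in> L2w w" "g \<in> L2w w"
  shows "(\<lambda>x. f x + g x) \<in> L2w w"
proof (rule L2w_dominated)
  show "integrable lebesgue (\<lambda>x. (2 * (cmod (f x))\<^sup>2 + 2 * (cmod (g x))\<^sup>2) * w x)"
    using assms[THEN L2w_integrable_square] by (simp add: distrib_right mult.assoc)
  show "AE x in lebesgue. (cmod (f x + g x))\<^sup>2 \<le> 2 * (cmod (f x))\<^sup>2 + 2 * (cmod (g x))\<^sup>2"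
    by (intro AE_I2 cmod_add_square_le)
qed (use assms[THEN L2w_measurable] in auto)

lemma L2w_mult:
  assumes "f \<in> L2w w"
  shows "(\<lambda>x. c * f x) \<in> L2w w"
  using assms L2w_measurable[OF assms]
  by (auto simp: L2w_def norm_mult power_mult_distrib mult.assoc)

lemma L2w_diff: "f \<in> L2w w \<Longrightarrow> g \<in> L2w w \<Longrightarrow> (\<lambda>x. f x - g x) \<in> L2w w"
  using L2w_add[OF _ L2w_mult[of g "- 1"]] by simp

lemma L2w_cong_AE:
  assumes "f \<in> L2w w" "AE x in lebesgue. f x = g x"
  shows "g \<in> L2w w"
proof (rule L2w_dominated)
  show "g \<in> borel_measurable lebesgue"
    using borel_measurable_AE[OF L2w_measurable[OF assms(1)] assms(2)] .
  show "AE x in lebesgue. (cmod (g x))\<^sup>2 \<le> (cmod (f x))\<^sup>2"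
    using assms(2) by eventually_elim auto
qed (rule L2w_integrable_square[OF assms(1)])

lemma integrable_inner:
  assumes "f \<in> L2w w" "g \<in> L2w w"
  shows "integrable lebesgue (\<lambda>x. f x * cnj (g x) * complex_of_real (w x))"
proof (rule Bochner_Integration.integrable_bound)
  show "integrable lebesgue (\<lambda>x. (cmod (f x))\<^sup>2 * w x + (cmod (g x))\<^sup>2 * w x)"
    using assms[THEN L2w_integrable_square] by simp
  show "AE x in lebesgue. norm (f x * cnj (g x) * complex_of_real (w x))
      \<le> norm ((cmod (f x))\<^sup>2 * w x + (cmod (g x))\<^sup>2 * w x)"
    using AE_pos
  proof eventually_elim
    case (elim x)
    have "2 * (cmod (f x) * cmod (g x)) \<le> (cmod (f x))\<^sup>2 + (cmod (g x))\<^sup>2"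
      using sum_squares_bound[of "cmod (f x)" "cmod (g x)"] by simp
    moreover have "0 \<le> cmod (f x) * cmod (g x)" by simp
    ultimately have "cmod (f x) * cmod (g x) \<le> (cmod (f x))\<^sup>2 + (cmod (g x))\<^sup>2" by linarith
    then have "cmod (f x) * cmod (g x) * w x \<le> ((cmod (f x))\<^sup>2 + (cmod (g x))\<^sup>2) * w x"
      using elim by (intro mult_right_mono) auto
    then show ?case using elim by (simp add: norm_mult distrib_right)
  qed
qed (intro measurable_inner L2w_measurable assms)

lemma integrable_L2w_weight:
  assumes "f \<in> L2w w"
  shows "integrable lebesgue (\<lambda>x. f x * complex_of_real (w x))"
  using integrable_inner[OF assms L2w_const[of 1]] by simp

lemma inner_w_add_left:
  assumes "f \<in> L2w w" "g \<in> L2w w" "h \<in> L2w w"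
  shows "inner_w w (\<lambda>x. a * f x + b * g x) h = a * inner_w w f h + b * inner_w w g h"
proof -
  have "inner_w w (\<lambda>x. a * f x + b * g x) h = (LINT x|lebesgue.
      a * (f x * cnj (h x) * complex_of_real (w x)) + b * (g x * cnj (h x) * complex_of_real (w x)))"
    unfolding inner_w_def by (intro Bochner_Integration.integral_cong) (auto simp: algebra_simps)
  also have "\<dots> = a * inner_w w f h + b * inner_w w g h"
    unfolding inner_w_def using integrable_inner[OF assms(1,3)] integrable_inner[OF assms(2,3)]
    by (subst Bochner_Integration.integral_add) auto
  finally show ?thesis .
qed

lemma inner_w_commute: "inner_w w g f = cnj (inner_w w f g)"
proof -
  have "inner_w w g f = (LINT x|lebesgue. cnj (f x * cnj (g x) * complex_of_real (w x)))"
    unfolding inner_w_def by (intro Bochner_Integration.integral_cong) auto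
  then show ?thesis unfolding inner_w_def by (simp only: Bochner_Integration.integral_cnj)
qed

lemma inner_w_add_right:
  assumes "f \<in> L2w w" "g \<in> L2w w" "h \<in> L2w w"
  shows "inner_w w h (\<lambda>x. a * f x + b * g x) = cnj a * inner_w w h f + cnj b * inner_w w h g"
  using inner_w_add_left[OF assms, of a b] by (simp add: inner_w_commute[of h])

lemma inner_w_cong_AE:
  assumes "AE x in lebesgue. f x = f' x" "AE x in lebesgue. g x = g' x"
    and "f \<in> L2w w" "f' \<in> L2w w" "g \<in> L2w w" "g' \<in> L2w w"
  shows "inner_w w f g = inner_w w f' g'"
  unfolding inner_w_def
proof (rule integral_cong_AE)
  show "AE x in lebesgue. f x * cnj (g x) * complex_of_real (w x) = f' x * cnj (g' x) * complex_of_real (w x)"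
    using assms(1,2) by eventually_elim simp
qed (intro measurable_inner L2w_measurable assms)+

lemma norm_w_square:
  "(norm_w w f)\<^sup>2 = (LINT x|lebesgue. (cmod (f x))\<^sup>2 * w x)"
proof -
  have "0 \<le> (LINT x|lebesgue. (cmod (f x))\<^sup>2 * w x)"
    using AE_pos by (intro integral_nonneg_AE) (auto elim: eventually_mono)
  then show ?thesis by (simp add: norm_w_def)
qed

lemma norm_w_nonneg: "0 \<le> norm_w w f"
  using AE_pos by (auto simp: norm_w_def intro!: integral_nonneg_AE elim: eventually_mono)

text \<open>
  The inequality of Cauchy and Schwarz before optimising over \<open>s\<close>. In this form it needs no case
  distinction, and a suitable sequence of values of \<open>s\<close> gives the continuity of the inner product.
\<close>

lemma inner_w_bound:
  assumes f: "f \<in> L2w w" and g: "g \<in> L2w w" and s: "s > 0"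
  shows "cmod (inner_w w f g) \<le> s * (norm_w w f)\<^sup>2 + (norm_w w g)\<^sup>2 / s"
proof -
  have "cmod (inner_w w f g) \<le> (LINT x|lebesgue. cmod (f x * cnj (g x) * complex_of_real (w x)))"
    unfolding inner_w_def by (rule integral_norm_bound)
  also have "\<dots> \<le> (LINT x|lebesgue. s * ((cmod (f x))\<^sup>2 * w x) + (cmod (g x))\<^sup>2 * w x / s)"
  proof (rule integral_mono_AE)
    show "integrable lebesgue (\<lambda>x. cmod (f x * cnj (g x) * complex_of_real (w x)))"
      by (intro integrable_norm integrable_inner f g)
    show "integrable lebesgue (\<lambda>x. s * ((cmod (f x))\<^sup>2 * w x) + (cmod (g x))\<^sup>2 * w x / s)"
      using f g by (intro Bochner_Integration.integrable_add integrable_mult_right integrable_divide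
          L2w_integrable_square)
    show "AE x in lebesgue. cmod (f x * cnj (g x) * complex_of_real (w x)) \<le>
        s * ((cmod (f x))\<^sup>2 * w x) + (cmod (g x))\<^sup>2 * w x / s"
      using AE_pos
    proof eventually_elim
      case (elim x)
      let ?a = "cmod (f x)" and ?b = "cmod (g x)"
      have "0 \<le> (s * ?a - ?b)\<^sup>2 / s + ?a * ?b" using s by simp
      also have "\<dots> = s * ?a\<^sup>2 + ?b\<^sup>2 / s - ?a * ?b"
        using s by (simp add: power2_eq_square field_simps)
      finally have "?a * ?b * w x \<le> (s * ?a\<^sup>2 + ?b\<^sup>2 / s) * w x"
        using elim by (intro mult_right_mono) auto
      then show ?case using elim by (simp add: norm_mult algebra_simps)
    qed
  qed
  also have "\<dots> = s * (norm_w w f)\<^sup>2 + (norm_w w g)\<^sup>2 / s"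
    using f[THEN L2w_integrable_square] g[THEN L2w_integrable_square] by (simp add: norm_w_square)
  finally show ?thesis .
qed

lemma inner_w_tendsto:
  assumes f: "f \<in> L2w w" and G: "\<And>n. G n \<in> L2w w" and g: "g \<in> L2w w"
    and lim: "(\<lambda>n. norm_w w (\<lambda>x. G n x - g x)) \<longlonglongrightarrow> 0"
  shows "(\<lambda>n. inner_w w f (G n)) \<longlonglongrightarrow> inner_w w f g"
proof -
  define d where "d n = norm_w w (\<lambda>x. G n x - g x)" for n
  \<comment> \<open>The summand \<open>1 / Suc n\<close> keeps \<open>s n\<close> positive when the distance \<open>d n\<close> is 0.\<close>
  define s where "s n = d n + 1 / real (Suc n)" for n
  have d: "0 \<le> d n" for n by (simp add: d_def norm_w_nonneg)
  then have s: "0 < s n" for n by (simp add: s_def add_nonneg_pos)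
  have "(\<lambda>n. 1 / real (Suc n)) \<longlonglongrightarrow> 0"
    using LIMSEQ_inverse_real_of_nat by (simp add: inverse_eq_divide)
  then have "(\<lambda>n. s n * (norm_w w f)\<^sup>2 + d n) \<longlonglongrightarrow> (0 + 0) * (norm_w w f)\<^sup>2 + 0"
    unfolding s_def using lim by (intro tendsto_intros) (auto simp: d_def)
  then have null: "(\<lambda>n. s n * (norm_w w f)\<^sup>2 + d n) \<longlonglongrightarrow> 0" by simp
  have bound: "norm (inner_w w f (G n) - inner_w w f g) \<le> s n * (norm_w w f)\<^sup>2 + d n" for n
  proof -
    have "inner_w w f (\<lambda>x. G n x - g x) = inner_w w f (G n) - inner_w w f g"
      using inner_w_add_right[OF G[of n] g f, of 1 "- 1"] by simp
    then have "norm (inner_w w f (G n) - inner_w w f g) \<le> s n * (norm_w w f)\<^sup>2 + (d n)\<^sup>2 / s n"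
      using inner_w_bound[OF f L2w_diff[OF G g] s, of n n] by (simp add: d_def)
    also have "(d n)\<^sup>2 / s n \<le> d n"
    proof -
      have "d n * d n \<le> d n * s n" using d by (intro mult_left_mono) (auto simp: s_def)
      then show ?thesis using s[of n] by (simp add: divide_le_eq power2_eq_square)
    qed
    finally show ?thesis by simp
  qed
  have "(\<lambda>n. inner_w w f (G n) - inner_w w f g) \<longlonglongrightarrow> 0"
    using bound by (intro Lim_null_comparison[OF _ null] always_eventually allI)
  then show ?thesis by (simp add: LIM_zero_iff)
qed

section \<open>The graph of the operator\<close>

text \<open>
  The integral with respect to the weighted measure and, as a function of the upper limit,
  \<open>cumulative g\<close>. In these terms the equation \<open>H_w f = g\<close> reads \<open>f = c + \<i> * cumulative g\<close>, and the values of \<open>f\<close>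
  at the two ends of the line are \<open>c\<close> and \<open>c + \<i> * integral_w g\<close>.
\<close>

definition integral_w :: "(real \<Rightarrow> complex) \<Rightarrow> complex" where
  "integral_w g = (LINT t|lebesgue. g t * complex_of_real (w t))"

definition cumulative :: "(real \<Rightarrow> complex) \<Rightarrow> real \<Rightarrow> complex" where
  "cumulative g = primitive (\<lambda>t. g t * complex_of_real (w t))"

lemma cumulative_add_mult:
  assumes "f \<in> L2w w" "g \<in> L2w w"
  shows "cumulative (\<lambda>x. a * f x + b * g x) x = a * cumulative f x + b * cumulative g x"
  using primitive_linear[OF assms[THEN integrable_L2w_weight], of a b x]
  by (simp add: cumulative_def algebra_simps)

lemma integral_w_eq_inner: "integral_w g = inner_w w g (\<lambda>x. 1)"
  by (simp add: integral_w_def inner_w_def)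

lemma integral_w_add_mult:
  assumes "f \<in> L2w w" "g \<in> L2w w"
  shows "integral_w (\<lambda>x. a * f x + b * g x) = a * integral_w f + b * integral_w g"
  unfolding integral_w_eq_inner by (intro inner_w_add_left assms L2w_const)

lemma L2w_cumulative:
  assumes "g \<in> L2w w"
  shows "cumulative g \<in> L2w w"
  unfolding cumulative_def using integrable_L2w_weight[OF assms]
  by (intro L2w_bounded[OF _ norm_primitive_le] measurable_primitive)

text \<open>
  The boundary form: the sum of \<open>cumulative\<close> and its formal adjoint is an operator of rank one. The adjoint of the differential operator is read off from this identity.
\<close>

lemma inner_cumulative:
  assumes g: "g \<in> L2w w" and v: "v \<in> L2w w"
  shows "inner_w w (cumulative g) v + inner_w w g (cumulative v) = integral_w g * cnj (integral_w v)"
proof -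
  let ?p = "\<lambda>t. g t * complex_of_real (w t)" and ?q = "\<lambda>t. cnj (v t * complex_of_real (w t))"
  have p: "integrable lebesgue ?p" by (rule integrable_L2w_weight[OF g])
  have q: "integrable lebesgue ?q"
    using integrable_L2w_weight[OF v] by (simp only: complex_integrable_cnj)
  have prim: "primitive ?q x = cnj (cumulative v x)" for x
  proof -
    have "primitive ?q x = (LINT t|lebesgue. cnj (indicator {..x} t *\<^sub>R (v t * complex_of_real (w t))))"
      unfolding primitive_def by (intro Bochner_Integration.integral_cong) (auto simp: indicator_def)
    then show ?thesis unfolding cumulative_def primitive_def by (simp only: Bochner_Integration.integral_cnj)
  qed
  have tot: "(LINT t|lebesgue. ?q t) = cnj (integral_w v)"
    unfolding integral_w_def by (rule Bochner_Integration.integral_cnj)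
  have "inner_w w (cumulative g) v = (LINT x|lebesgue. primitive ?p x * ?q x)"
    unfolding inner_w_def cumulative_def by (intro Bochner_Integration.integral_cong) auto
  moreover have "inner_w w g (cumulative v) = (LINT x|lebesgue. ?p x * primitive ?q x)"
    unfolding inner_w_def prim by (intro Bochner_Integration.integral_cong) auto
  ultimately show ?thesis
    using primitive_by_parts[OF p q] unfolding tot by (simp add: integral_w_def)
qed

lemma continuous_AE_eq_imp_eq:
  fixes F G :: "real \<Rightarrow> complex"
  assumes "continuous_on UNIV F" "continuous_on UNIV G" "AE x in lebesgue. F x = G x"
  shows "F = G"
proof -
  have "open {x. F x \<noteq> G x}" using assms by (intro open_Collect_neq)
  moreover have "{x. F x \<noteq> G x} \<in> null_sets lebesgue"
    using assms(3) calculation by (subst AE_iff_null_sets) auto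
  ultimately have "{x. F x \<noteq> G x} = {}"
    using open_not_negligible negligible_iff_null_sets by blast
  then show ?thesis by auto
qed

text \<open>
  The domain in integrated form. If \<open>g = H_w f\<close> lies in the weighted space, the weak derivative
  \<open>\<i> * g * w\<close> is integrable, because the weighted measure is finite. Hence \<open>f\<close> is a primitive of it
  up to a constant \<open>c\<close>, it has limits at both ends, and the boundary condition becomes an equation
  for \<open>c\<close> and the integral of \<open>g\<close>. All later arguments use this description only.
\<close>

lemma graph_iff:
  "(f, g) \<in> operator_graph w (D_alpha w \<alpha>) (H_w w) \<longleftrightarrow>
    f \<in> L2w w \<and> g \<in> L2w w \<and>
    (\<exists>c. (AE x in lebesgue. f x = c + \<i> * cumulative g x) \<and> c + \<i> * integral_w g = \<alpha> * c)"
    (is "?L \<longleftrightarrow> ?R")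
proof -
  have prim_p: "primitive (\<lambda>t. \<i> * (g t * complex_of_real (w t))) x = \<i> * cumulative g x"
    if "g \<in> L2w w" for x
    using primitive_linear[OF integrable_L2w_weight[OF that] integrable_L2w_weight[OF that], of \<i> 0 x]
    by (simp add: cumulative_def)
  have int_p: "integrable lebesgue (\<lambda>t. \<i> * (g t * complex_of_real (w t)))" if "g \<in> L2w w"
    by (intro integrable_mult_right integrable_L2w_weight that)
  have cont: "continuous_on UNIV (\<lambda>x. c + \<i> * cumulative g x)"
    and bot: "((\<lambda>x. c + \<i> * cumulative g x) \<longlongrightarrow> c + \<i> * 0) at_bot"
    and top: "((\<lambda>x. c + \<i> * cumulative g x) \<longlongrightarrow> c + \<i> * integral_w g) at_top"
    if "g \<in> L2w w" for c
    using integrable_L2w_weight[OF that] unfolding cumulative_def integral_w_def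
    by (intro continuous_intros tendsto_intros continuous_primitive primitive_at_bot
        primitive_at_top; simp)+
  show ?thesis
  proof
    assume ?L
    then have f: "f \<in> L2w w" and g: "g \<in> L2w w" and "\<exists>h. has_weak_deriv f h"
      and ae: "AE x in lebesgue. g x = H_w w f x"
      and lim: "\<exists>F a b. continuous_on UNIV F \<and> ae_eq f F \<and>
                 (F \<longlongrightarrow> a) at_bot \<and> (F \<longlongrightarrow> b) at_top \<and> b = \<alpha> * a"
      unfolding operator_graph_def D_alpha_def by (auto simp: ae_eq_def[of g])
    from this(3) have h: "has_weak_deriv f (weak_deriv f)"
      unfolding weak_deriv_def by (rule someI_ex)
    obtain F a b where F: "continuous_on UNIV F" "AE x in lebesgue. f x = F x"
      "(F \<longlongrightarrow> a) at_bot" "(F \<longlongrightarrow> b) at_top" "b = \<alpha> * a"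
      using lim unfolding ae_eq_def by blast
    let ?p = "\<lambda>t. \<i> * (g t * complex_of_real (w t))"
    have eq: "AE x in lebesgue. weak_deriv f x = ?p x"
      using ae AE_pos by eventually_elim (auto simp: H_w_def field_simps)
    have meas: "weak_deriv f \<in> borel_measurable lebesgue"
      using h by (intro locally_integrable_measurable) (auto simp: has_weak_deriv_def)
    then have int_h: "integrable lebesgue (weak_deriv f)"
      using integrable_cong_AE[OF meas _ eq] int_p[OF g] by auto
    obtain c where "AE x in lebesgue. f x = c + primitive (weak_deriv f) x"
      using has_integrable_weak_deriv_imp_primitive[OF h int_h] by blast
    then have c: "AE x in lebesgue. f x = c + \<i> * cumulative g x"
      using primitive_cong_AE[OF eq int_h int_p[OF g]] prim_p[OF g] by simp
    then have "AE x in lebesgue. F x = c + \<i> * cumulative g x"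
      using F(2) by eventually_elim simp
    from continuous_AE_eq_imp_eq[OF F(1) cont[OF g] this]
    have F_eq: "F = (\<lambda>x. c + \<i> * cumulative g x)" .
    have "a = c"
      using tendsto_unique[OF _ F(3)[unfolded F_eq] bot[OF g]] by simp
    moreover have "b = c + \<i> * integral_w g"
      using tendsto_unique[OF _ F(4)[unfolded F_eq] top[OF g]] by simp
    ultimately show ?R using f g c F(5) by auto
  next
    assume ?R
    then obtain c where f: "f \<in> L2w w" and g: "g \<in> L2w w"
      and c: "AE x in lebesgue. f x = c + \<i> * cumulative g x" "c + \<i> * integral_w g = \<alpha> * c"
      by blast
    let ?p = "\<lambda>t. \<i> * (g t * complex_of_real (w t))"
    have c': "AE x in lebesgue. c + primitive ?p x = f x"
      using c(1) by eventually_elim (simp add: prim_p[OF g])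
    have "has_weak_deriv (\<lambda>x. c + primitive ?p x) ?p"
      by (intro has_weak_deriv_primitive int_p g)
    then have p: "has_weak_deriv f ?p"
      using measurable_primitive[OF int_p[OF g]] L2w_measurable[OF f]
      by (subst has_weak_deriv_cong_AE[OF c', symmetric]) auto
    then have "has_weak_deriv f (weak_deriv f)"
      unfolding weak_deriv_def by (rule someI[where P = "has_weak_deriv f"])
    from has_weak_deriv_unique[OF this p]
    have H: "AE x in lebesgue. g x = H_w w f x"
      using AE_pos by eventually_elim (auto simp: H_w_def field_simps)
    then have "H_w w f \<in> L2w w" by (rule L2w_cong_AE[OF g])
    moreover have "\<exists>F a b. continuous_on UNIV F \<and> ae_eq f F \<and>
                 (F \<longlongrightarrow> a) at_bot \<and> (F \<longlongrightarrow> b) at_top \<and> b = \<alpha> * a"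
      using cont[OF g, of c] bot[OF g, of c] top[OF g, of c] c by (auto simp: ae_eq_def)
    ultimately show ?L
      using f g p H by (auto simp: operator_graph_def D_alpha_def ae_eq_def)
  qed
qed

text \<open>
  Linearity is read off from the integrated form. That the graph is single-valued is a property of
  the weak derivative: it depends only on the class of \<open>f\<close>.
\<close>

lemma linear_operator_graph:
  "linear_operator_w w (operator_graph w (D_alpha w \<alpha>) (H_w w))" (is "linear_operator_w w ?G")
  unfolding linear_operator_w_def
proof (intro conjI)
  have lin: "(\<lambda>x. a * f x + b * f' x, \<lambda>x. a * g x + b * g' x) \<in> ?G"
    if fg: "(f, g) \<in> ?G" "(f', g') \<in> ?G" for a b f f' g g'
  proof -
    have L: "f \<in> L2w w" "g \<in> L2w w" "f' \<in> L2w w" "g' \<in> L2w w"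
      using fg by (auto simp: graph_iff)
    obtain c where c: "AE x in lebesgue. f x = c + \<i> * cumulative g x" "c + \<i> * integral_w g = \<alpha> * c"
      using fg by (auto simp: graph_iff)
    obtain c' where c': "AE x in lebesgue. f' x = c' + \<i> * cumulative g' x" "c' + \<i> * integral_w g' = \<alpha> * c'"
      using fg by (auto simp: graph_iff)
    have "AE x in lebesgue. a * f x + b * f' x
        = (a * c + b * c') + \<i> * cumulative (\<lambda>x. a * g x + b * g' x) x"
      using c(1) c'(1) by eventually_elim (simp add: cumulative_add_mult L algebra_simps)
    moreover have "(a * c + b * c') + \<i> * integral_w (\<lambda>x. a * g x + b * g' x)
        = a * (c + \<i> * integral_w g) + b * (c' + \<i> * integral_w g')"
      by (simp add: integral_w_add_mult L algebra_simps)
    then have "(a * c + b * c') + \<i> * integral_w (\<lambda>x. a * g x + b * g' x) = \<alpha> * (a * c + b * c')"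
      by (simp add: c(2) c'(2) algebra_simps)
    ultimately show ?thesis
      unfolding graph_iff by (intro conjI L2w_add L2w_mult L exI[of _ "a * c + b * c'"])
  qed
  show "?G \<subseteq> L2w w \<times> L2w w" by (auto simp: graph_iff)
  show "(\<lambda>x. 0, \<lambda>x. 0) \<in> ?G"
    unfolding graph_iff
    by (intro conjI L2w_const exI[of _ 0]) (auto simp: cumulative_def integral_w_def primitive_def)
  show "\<forall>(f, g) \<in> ?G. \<forall>(f', g') \<in> ?G. (\<lambda>x. f x + f' x, \<lambda>x. g x + g' x) \<in> ?G"
    using lin[of _ _ _ _ 1 1] by auto
  show "\<forall>c. \<forall>(f, g) \<in> ?G. (\<lambda>x. c * f x, \<lambda>x. c * g x) \<in> ?G"
    using lin[of _ _ _ _ _ 0] by auto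
  show "\<forall>(f, g) \<in> ?G. \<forall>f' \<in> L2w w. \<forall>g' \<in> L2w w. ae_eq f f' \<and> ae_eq g g' \<longrightarrow> (f', g') \<in> ?G"
  proof (clarify)
    fix f g f' g'
    assume G: "(f, g) \<in> ?G" and L: "f' \<in> L2w w" "g' \<in> L2w w" and ae: "ae_eq f f'" "ae_eq g g'"
    obtain c where c: "AE x in lebesgue. f x = c + \<i> * cumulative g x" "c + \<i> * integral_w g = \<alpha> * c"
      using G by (auto simp: graph_iff)
    have g: "g \<in> L2w w" using G by (auto simp: graph_iff)
    have eq: "AE x in lebesgue. g x * complex_of_real (w x) = g' x * complex_of_real (w x)"
      using ae(2) unfolding ae_eq_def by eventually_elim simp
    have "cumulative g = cumulative g'"
      unfolding cumulative_def
      using primitive_cong_AE[OF eq integrable_L2w_weight[OF g] integrable_L2w_weight[OF L(2)]] by auto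
    moreover have "integral_w g = integral_w g'"
      unfolding integral_w_def using integrable_L2w_weight[OF g] integrable_L2w_weight[OF L(2)] eq
      by (intro integral_cong_AE) auto
    moreover have "AE x in lebesgue. f' x = c + \<i> * cumulative g x"
      using ae(1) c(1) unfolding ae_eq_def by eventually_elim simp
    ultimately show "(f', g') \<in> ?G" using c L by (auto simp: graph_iff)
  qed
  show "\<forall>(f, g) \<in> ?G. \<forall>(f', g') \<in> ?G. ae_eq f f' \<longrightarrow> ae_eq g g'"
  proof (clarify)
    fix f g f' g' assume G: "(f, g) \<in> ?G" "(f', g') \<in> ?G" and ae: "ae_eq f f'"
    have "has_weak_deriv f = has_weak_deriv f'"
      using has_weak_deriv_cong_AE[OF ae[unfolded ae_eq_def]] G
      by (auto simp: graph_iff L2w_measurable)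
    then have "H_w w f = H_w w f'" by (simp add: H_w_def weak_deriv_def)
    then show "ae_eq g g'"
      using G by (auto simp: operator_graph_def ae_eq_def elim!: eventually_elim2)
  qed
qed

section \<open>The adjoint\<close>

text \<open>
  With \<open>f = c + \<i> * cumulative g\<close> and \<open>u = d + \<i> * cumulative v\<close>, the boundary form turns the difference
  of the two inner products into a multiple of \<open>\<alpha> * cnj \<alpha> - 1\<close>.
\<close>

lemma graph_subset_adjoint:
  assumes alpha: "cmod \<alpha> = 1"
  shows "operator_graph w (D_alpha w \<alpha>) (H_w w) \<subseteq> adjoint_w w (operator_graph w (D_alpha w \<alpha>) (H_w w))"
    (is "?G \<subseteq> adjoint_w w ?G")
proof clarify
  fix u v assume uv: "(u, v) \<in> ?G"
  have "inner_w w g u = inner_w w f v" if fg: "(f, g) \<in> ?G" for f g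
  proof -
    have L: "f \<in> L2w w" "g \<in> L2w w" "u \<in> L2w w" "v \<in> L2w w"
      using fg uv by (auto simp: graph_iff)
    obtain c where c: "AE x in lebesgue. f x = c * 1 + \<i> * cumulative g x" "c + \<i> * integral_w g = \<alpha> * c"
      using fg by (auto simp: graph_iff)
    obtain d where d: "AE x in lebesgue. u x = d * 1 + \<i> * cumulative v x" "d + \<i> * integral_w v = \<alpha> * d"
      using uv by (auto simp: graph_iff)
    have "inner_w w g u = inner_w w g (\<lambda>x. d * 1 + \<i> * cumulative v x)"
      using L d(1) by (intro inner_w_cong_AE L2w_add L2w_mult L2w_cumulative L2w_const) auto
    also have "\<dots> = cnj d * integral_w g - \<i> * inner_w w g (cumulative v)"
      using inner_w_add_right[OF L2w_const[of 1] L2w_cumulative[OF L(4)] L(2), of d \<i>]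
      by (simp add: integral_w_eq_inner)
    finally have 1: "inner_w w g u = cnj d * integral_w g - \<i> * inner_w w g (cumulative v)" .
    have "inner_w w f v = inner_w w (\<lambda>x. c * 1 + \<i> * cumulative g x) v"
      using L c(1) by (intro inner_w_cong_AE L2w_add L2w_mult L2w_cumulative L2w_const) auto
    also have "\<dots> = c * cnj (integral_w v) + \<i> * inner_w w (cumulative g) v"
      using inner_w_add_left[OF L2w_const[of 1] L2w_cumulative[OF L(2)] L(4), of c \<i>]
      by (simp add: integral_w_eq_inner inner_w_commute[of "\<lambda>x. 1"])
    finally have "inner_w w g u - inner_w w f v = cnj d * integral_w g - c * cnj (integral_w v)
        - \<i> * (inner_w w (cumulative g) v + inner_w w g (cumulative v))"
      using 1 by (simp add: algebra_simps)
    then have diff: "inner_w w g u - inner_w w f v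
        = cnj d * integral_w g - c * cnj (integral_w v) - \<i> * (integral_w g * cnj (integral_w v))"
      using inner_cumulative[OF L(2,4)] by simp
    have tg: "integral_w g = - \<i> * (\<alpha> - 1) * c"
    proof -
      have "\<i> * integral_w g = (\<alpha> - 1) * c"
        using c(2) by (simp add: left_diff_distrib eq_diff_eq add.commute)
      from arg_cong[OF this, of "\<lambda>z. - \<i> * z"] show ?thesis by (simp add: mult.assoc)
    qed
    have "integral_w v = - \<i> * (\<alpha> - 1) * d"
    proof -
      have "\<i> * integral_w v = (\<alpha> - 1) * d"
        using d(2) by (simp add: left_diff_distrib eq_diff_eq add.commute)
      from arg_cong[OF this, of "\<lambda>z. - \<i> * z"] show ?thesis by (simp add: mult.assoc)
    qed
    then have tv: "cnj (integral_w v) = \<i> * (cnj \<alpha> - 1) * cnj d" by simp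
    have "\<alpha> * cnj \<alpha> = 1" using complex_norm_square[of \<alpha>] alpha by simp
    have "cnj d * integral_w g - c * cnj (integral_w v) - \<i> * (integral_w g * cnj (integral_w v))
        = - \<i> * c * cnj d * (\<alpha> * cnj \<alpha> - 1)"
      unfolding tg tv by (simp add: algebra_simps)
    also have "\<dots> = 0" using \<open>\<alpha> * cnj \<alpha> = 1\<close> by simp
    finally have "cnj d * integral_w g - c * cnj (integral_w v) - \<i> * (integral_w g * cnj (integral_w v)) = 0" .
    then show ?thesis using diff by simp
  qed
  then show "(u, v) \<in> adjoint_w w ?G"
    using uv by (auto simp: adjoint_w_def graph_iff)
qed

lemma total_weight_pos: "0 < (LINT x|lebesgue. w x)"
proof -
  have nn: "AE x in lebesgue. 0 \<le> w x" using AE_pos by eventually_elim simp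
  have "(LINT x|lebesgue. w x) \<noteq> 0"
  proof
    assume "(LINT x|lebesgue. w x) = 0"
    then have "AE x in lebesgue. w x = 0"
      using integral_nonneg_eq_0_iff_AE[OF integrable_weight nn] by simp
    then have "AE x in (lebesgue :: real measure). False"
      using AE_pos by eventually_elim simp
    then show False using AE_iff_null_sets[of UNIV "lebesgue :: real measure"] by auto
  qed
  then show ?thesis using integral_nonneg_AE[OF nn] by linarith
qed

text \<open>
  Let \<open>(u, v)\<close> be in the adjoint and \<open>z = u - \<i> * cumulative v\<close>. The boundary form gives
  \<open>inner_w w g z = \<alpha> * c * cnj (integral_w v)\<close> for all \<open>g\<close> and \<open>c\<close> that are compatible with the boundary condition.
  Taking \<open>c = 0\<close>, every \<open>g\<close> with integral 0 is orthogonal to \<open>z\<close>; applied to \<open>z\<close> minus its mean, this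
  shows that \<open>z\<close> is constant. Taking \<open>c = 1\<close> and \<open>g\<close> constant then yields the boundary condition
  for \<open>u\<close>.
\<close>

lemma adjoint_subset_graph:
  assumes alpha: "cmod \<alpha> = 1"
  shows "adjoint_w w (operator_graph w (D_alpha w \<alpha>) (H_w w)) \<subseteq> operator_graph w (D_alpha w \<alpha>) (H_w w)"
    (is "adjoint_w w ?G \<subseteq> ?G")
proof clarify
  fix u v assume "(u, v) \<in> adjoint_w w ?G"
  then have u: "u \<in> L2w w" and v: "v \<in> L2w w"
    and adj: "\<And>f g. (f, g) \<in> ?G \<Longrightarrow> inner_w w g u = inner_w w f v"
    by (auto simp: adjoint_w_def)
  define z where "z x = 1 * u x + (- \<i>) * cumulative v x" for x
  have z: "z \<in> L2w w"
    unfolding z_def[abs_def] by (intro L2w_add L2w_mult L2w_cumulative u v)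
  have key: "inner_w w g z = \<alpha> * c * cnj (integral_w v)"
    if g: "g \<in> L2w w" and c: "c + \<i> * integral_w g = \<alpha> * c" for g c
  proof -
    have "(\<lambda>x. c * 1 + \<i> * cumulative g x, g) \<in> ?G"
      unfolding graph_iff using g c
      by (intro conjI L2w_add L2w_mult L2w_cumulative L2w_const exI[of _ c]) auto
    from adj[OF this]
    have 1: "inner_w w g u = c * cnj (integral_w v) + \<i> * inner_w w (cumulative g) v"
      using inner_w_add_left[OF L2w_const[of 1] L2w_cumulative[OF g] v, of c \<i>]
      by (simp add: integral_w_eq_inner inner_w_commute[of "\<lambda>x. 1"])
    have "inner_w w g z = inner_w w g u + \<i> * inner_w w g (cumulative v)"
      unfolding z_def[abs_def] using inner_w_add_right[OF u L2w_cumulative[OF v] g, of 1 "- \<i>"] by simp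
    also have "\<dots> = c * cnj (integral_w v) + \<i> * (inner_w w (cumulative g) v + inner_w w g (cumulative v))"
      unfolding 1 by (simp add: algebra_simps)
    also have "\<dots> = (c + \<i> * integral_w g) * cnj (integral_w v)"
      using inner_cumulative[OF g v] by (simp add: algebra_simps)
    finally show ?thesis using c by simp
  qed
  let ?m = "complex_of_real (LINT x|lebesgue. w x)"
  have m: "?m \<noteq> 0" using total_weight_pos by simp
  have integral_w_const: "integral_w (\<lambda>x. k) = k * ?m" for k
  proof -
    have "integral_w (\<lambda>x. k) = k * (LINT x|lebesgue. complex_of_real (w x))"
      unfolding integral_w_def by (rule integral_mult_right_zero)
    then show ?thesis by simp
  qed
  define d where "d = integral_w z / ?m"
  \<comment> \<open>The deviation of \<open>z\<close> from its mean; the factors 1 put it into the shape of a linear combination.\<close>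
  define y where "y x = 1 * z x + (- d) * 1" for x
  have y: "y \<in> L2w w"
    unfolding y_def[abs_def] by (intro L2w_add L2w_mult L2w_const z)
  have "integral_w y = 1 * integral_w z + (- d) * integral_w (\<lambda>x. 1)"
    unfolding y_def[abs_def] by (rule integral_w_add_mult[OF z L2w_const])
  then have integral_w_y: "integral_w y = 0" using m by (simp add: integral_w_const d_def)
  have "inner_w w y z = 0" using key[OF y, of 0] integral_w_y by simp
  moreover have "inner_w w y (\<lambda>x. 1 * z x + (- d) * 1) = 1 * inner_w w y z + cnj (- d) * inner_w w y (\<lambda>x. 1)"
    using inner_w_add_right[OF z L2w_const[of 1] y, of 1 "- d"] by simp
  ultimately have "inner_w w y y = 0"
    using integral_w_y unfolding y_def[abs_def, symmetric] integral_w_eq_inner by simp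
  moreover have "inner_w w y y = complex_of_real (LINT x|lebesgue. (cmod (y x))\<^sup>2 * w x)"
    unfolding inner_w_def integral_complex_of_real[symmetric]
    by (intro Bochner_Integration.integral_cong) (auto simp: complex_norm_square[symmetric] simp del: of_real_power)
  ultimately have "(LINT x|lebesgue. (cmod (y x))\<^sup>2 * w x) = 0" by simp
  moreover have "AE x in lebesgue. 0 \<le> (cmod (y x))\<^sup>2 * w x"
    using AE_pos by eventually_elim simp
  ultimately have "AE x in lebesgue. (cmod (y x))\<^sup>2 * w x = 0"
    using integral_nonneg_eq_0_iff_AE[OF L2w_integrable_square[OF y]] by simp
  then have ae: "AE x in lebesgue. z x = d"
    using AE_pos by eventually_elim (simp add: y_def)
  \<comment> \<open>The constant function for which the boundary condition holds with \<open>c = 1\<close>.\<close>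
  define k where "k = - \<i> * (\<alpha> - 1) / ?m"
  have km: "k * ?m = - \<i> * (\<alpha> - 1)" using m by (simp add: k_def)
  have "1 + \<i> * integral_w (\<lambda>x. k) = \<alpha> * 1"
    unfolding integral_w_const km by (simp add: algebra_simps)
  from key[OF L2w_const this] have "inner_w w (\<lambda>x. k) z = \<alpha> * cnj (integral_w v)" by simp
  moreover have "inner_w w (\<lambda>x. k) z = cnj d * (k * ?m)"
  proof -
    have "inner_w w (\<lambda>x. k) z = inner_w w (\<lambda>x. k) (\<lambda>x. d * 1 + 0 * 1)"
      using ae by (intro inner_w_cong_AE z L2w_const) auto
    also have "\<dots> = cnj d * integral_w (\<lambda>x. k)"
      unfolding integral_w_eq_inner
      using inner_w_add_right[OF L2w_const[of 1] L2w_const[of 1] L2w_const[of k], of d 0] by simp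
    finally show ?thesis unfolding integral_w_const .
  qed
  ultimately have "- \<i> * (\<alpha> - 1) * cnj d = \<alpha> * cnj (integral_w v)"
    unfolding km by (simp add: mult.commute)
  from arg_cong[OF this, of cnj] have "\<i> * (cnj \<alpha> - 1) * d = cnj \<alpha> * integral_w v" by simp
  then have "\<alpha> * (\<i> * (cnj \<alpha> - 1) * d) = \<alpha> * (cnj \<alpha> * integral_w v)" by simp
  then have "\<i> * (\<alpha> * cnj \<alpha> - \<alpha>) * d = (\<alpha> * cnj \<alpha>) * integral_w v"
    by (simp add: algebra_simps)
  moreover have "\<alpha> * cnj \<alpha> = 1" using complex_norm_square[of \<alpha>] alpha by simp
  ultimately have tv: "\<i> * (1 - \<alpha>) * d = integral_w v" by simp
  have "d + \<i> * integral_w v = \<alpha> * d"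
    unfolding tv[symmetric] by (simp add: algebra_simps)
  moreover have "AE x in lebesgue. u x = d + \<i> * cumulative v x"
    using ae by eventually_elim (auto simp: z_def algebra_simps)
  ultimately show "(u, v) \<in> ?G" using u v by (auto simp: graph_iff)
qed

text \<open>
  An adjoint is closed, by continuity of the inner product.
\<close>

lemma closure_subset_adjoint:
  assumes G: "G \<subseteq> L2w w \<times> L2w w" and sym: "G \<subseteq> adjoint_w w G"
  shows "closure_w w G \<subseteq> adjoint_w w G"
proof clarify
  fix u v assume "(u, v) \<in> closure_w w G"
  then obtain F T where uv: "u \<in> L2w w" "v \<in> L2w w" and FT: "\<And>n. (F n, T n) \<in> G"
    and F: "(\<lambda>n. norm_w w (\<lambda>x. F n x - u x)) \<longlonglongrightarrow> 0"
    and T: "(\<lambda>n. norm_w w (\<lambda>x. T n x - v x)) \<longlonglongrightarrow> 0"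
    by (auto simp: closure_w_def)
  have L: "F n \<in> L2w w" "T n \<in> L2w w" for n using FT[of n] G by auto
  have "inner_w w g u = inner_w w f v" if fg: "(f, g) \<in> G" for f g
  proof -
    have "f \<in> L2w w" "g \<in> L2w w" using fg G by auto
    then have "(\<lambda>n. inner_w w g (F n)) \<longlonglongrightarrow> inner_w w g u" "(\<lambda>n. inner_w w f (T n)) \<longlonglongrightarrow> inner_w w f v"
      using L uv F T by (auto intro: inner_w_tendsto)
    moreover have "inner_w w g (F n) = inner_w w f (T n)" for n
      using FT[of n] sym fg by (auto simp: adjoint_w_def)
    ultimately show ?thesis using LIMSEQ_unique by auto
  qed
  then show "(u, v) \<in> adjoint_w w G" using uv by (auto simp: adjoint_w_def)
qed

lemma subset_closure:
  assumes "G \<subseteq> L2w w \<times> L2w w"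
  shows "G \<subseteq> closure_w w G"
proof clarify
  fix u v assume uv: "(u, v) \<in> G"
  have "norm_w w (\<lambda>x. f x - f x) = 0" for f by (simp add: norm_w_def)
  then have "(\<lambda>n::nat. norm_w w (\<lambda>x. u x - u x)) \<longlonglongrightarrow> 0"
    "(\<lambda>n::nat. norm_w w (\<lambda>x. v x - v x)) \<longlonglongrightarrow> 0"
    by simp_all
  then have "\<exists>F T. (\<forall>n::nat. (F n, T n) \<in> G) \<and>
               (\<lambda>n. norm_w w (\<lambda>x. F n x - u x)) \<longlonglongrightarrow> 0 \<and>
               (\<lambda>n. norm_w w (\<lambda>x. T n x - v x)) \<longlonglongrightarrow> 0"
    using uv by - (rule exI[of _ "\<lambda>n. u"], rule exI[of _ "\<lambda>n. v"], intro conjI allI)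
  then show "(u, v) \<in> closure_w w G"
    using assms uv by (auto simp: closure_w_def)
qed

section \<open>Density of the domain\<close>

text \<open>
  Closure under combinations of two vectors is stated in one clause, as the approximation lemmas
  below use sums and scalar multiples together.
\<close>

definition linear_subspace :: "(real \<Rightarrow> complex) set \<Rightarrow> bool" where
  "linear_subspace S \<longleftrightarrow> S \<subseteq> L2w w \<and> (\<lambda>x. 0) \<in> S \<and>
     (\<forall>f\<in>S. \<forall>g\<in>S. \<forall>a b. (\<lambda>x. a * f x + b * g x) \<in> S)"

lemma linear_subspaceD:
  assumes "linear_subspace S"
  shows "S \<subseteq> L2w w" "(\<lambda>x. 0) \<in> S"
    "f \<in> S \<Longrightarrow> g \<in> S \<Longrightarrow> (\<lambda>x. a * f x + b * g x) \<in> S"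
  using assms by (auto simp: linear_subspace_def)

definition approximable :: "(real \<Rightarrow> complex) set \<Rightarrow> (real \<Rightarrow> complex) \<Rightarrow> bool" where
  "approximable S u \<longleftrightarrow> u \<in> L2w w \<and> (\<forall>e>0. \<exists>f\<in>S. (norm_w w (\<lambda>x. f x - u x))\<^sup>2 < e)"

lemma approximable_mem: "S \<subseteq> L2w w \<Longrightarrow> f \<in> S \<Longrightarrow> approximable S f"
  by (auto simp: approximable_def norm_w_def intro!: bexI[of _ f])

lemma norm_w_add_square_le:
  assumes "f \<in> L2w w" "g \<in> L2w w"
  shows "(norm_w w (\<lambda>x. f x + g x))\<^sup>2 \<le> 2 * (norm_w w f)\<^sup>2 + 2 * (norm_w w g)\<^sup>2"
proof -
  have "(norm_w w (\<lambda>x. f x + g x))\<^sup>2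
      \<le> (LINT x|lebesgue. 2 * ((cmod (f x))\<^sup>2 * w x) + 2 * ((cmod (g x))\<^sup>2 * w x))"
    unfolding norm_w_square
  proof (rule integral_mono_AE)
    show "AE x in lebesgue. (cmod (f x + g x))\<^sup>2 * w x \<le> 2 * ((cmod (f x))\<^sup>2 * w x) + 2 * ((cmod (g x))\<^sup>2 * w x)"
      using AE_pos
    proof eventually_elim
      case (elim x)
      have "(cmod (f x + g x))\<^sup>2 * w x \<le> (2 * (cmod (f x))\<^sup>2 + 2 * (cmod (g x))\<^sup>2) * w x"
        using elim by (intro mult_right_mono cmod_add_square_le) auto
      then show ?case by (simp add: distrib_right mult.assoc)
    qed
  qed (use L2w_add[OF assms] assms in \<open>auto intro!: L2w_integrable_square\<close>)
  also have "\<dots> = 2 * (norm_w w f)\<^sup>2 + 2 * (norm_w w g)\<^sup>2"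
    unfolding norm_w_square using assms[THEN L2w_integrable_square] by simp
  finally show ?thesis .
qed

lemma norm_w_mult_square: "(norm_w w (\<lambda>x. c * f x))\<^sup>2 = (cmod c)\<^sup>2 * (norm_w w f)\<^sup>2"
  unfolding norm_w_square by (simp add: norm_mult power_mult_distrib mult.assoc)

lemma approximable_limit:
  assumes S: "S \<subseteq> L2w w" and U: "\<And>n. approximable S (U n)" and u: "u \<in> L2w w"
    and lim: "(\<lambda>n. (norm_w w (\<lambda>x. U n x - u x))\<^sup>2) \<longlonglongrightarrow> 0"
  shows "approximable S u"
  unfolding approximable_def
proof (intro conjI u allI impI)
  fix e :: real assume e: "e > 0"
  obtain n where n: "(norm_w w (\<lambda>x. U n x - u x))\<^sup>2 < e / 4"
    using order_tendstoD(2)[OF lim, of "e / 4"] e by (auto simp: eventually_sequentially)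
  obtain f where f: "f \<in> S" "(norm_w w (\<lambda>x. f x - U n x))\<^sup>2 < e / 4"
    using U[of n] e unfolding approximable_def by (meson divide_pos_pos zero_less_numeral)
  have L: "f \<in> L2w w" "U n \<in> L2w w" using f S U by (auto simp: approximable_def)
  have "(norm_w w (\<lambda>x. (f x - U n x) + (U n x - u x)))\<^sup>2 < e"
    using norm_w_add_square_le[OF L2w_diff[OF L] L2w_diff[OF L(2) u]] f n by linarith
  then show "\<exists>f\<in>S. (norm_w w (\<lambda>x. f x - u x))\<^sup>2 < e" using f by auto
qed

text \<open>
  The closure of a set is stable under dominated convergence almost everywhere. All further
  members of the closure of the domain are produced by this lemma.
\<close>

lemma approximable_dominated_limit:
  assumes S: "S \<subseteq> L2w w" and U: "\<And>n. approximable S (U n)"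
    and u: "u \<in> L2w w" and b: "b \<in> L2w w"
    and lim: "AE x in lebesgue. (\<lambda>n. U n x) \<longlonglongrightarrow> u x"
    and bound: "\<And>n x. cmod (U n x) \<le> cmod (b x)"
  shows "approximable S u"
proof (rule approximable_limit[OF S U u])
  have UL: "U n \<in> L2w w" for n using U by (simp add: approximable_def)
  have "(\<lambda>n. LINT x|lebesgue. (cmod (U n x - u x))\<^sup>2 * w x) \<longlonglongrightarrow> (LINT x|lebesgue. (0 :: real) * w x)"
  proof (rule integral_dominated_convergence)
    show "integrable lebesgue (\<lambda>x. 2 * ((cmod (b x))\<^sup>2 * w x) + 2 * ((cmod (u x))\<^sup>2 * w x))"
      using b u by (intro Bochner_Integration.integrable_add integrable_mult_right L2w_integrable_square)
    show "AE x in lebesgue. (\<lambda>n. (cmod (U n x - u x))\<^sup>2 * w x) \<longlonglongrightarrow> 0 * w x"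
      using lim
    proof eventually_elim
      case (elim x)
      then have "(\<lambda>n. (cmod (U n x - u x))\<^sup>2 * w x) \<longlonglongrightarrow> (cmod (u x - u x))\<^sup>2 * w x"
        by (intro tendsto_intros)
      then show ?case by simp
    qed
    show "AE x in lebesgue. norm ((cmod (U n x - u x))\<^sup>2 * w x)
        \<le> 2 * ((cmod (b x))\<^sup>2 * w x) + 2 * ((cmod (u x))\<^sup>2 * w x)" for n
      using AE_pos
    proof eventually_elim
      case (elim x)
      have "(cmod (U n x - u x))\<^sup>2 \<le> 2 * (cmod (U n x))\<^sup>2 + 2 * (cmod (u x))\<^sup>2"
        using cmod_add_square_le[of "U n x" "- u x"] by simp
      also have "(cmod (U n x))\<^sup>2 \<le> (cmod (b x))\<^sup>2"
        using bound by (intro power_mono) auto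
      finally have "(cmod (U n x - u x))\<^sup>2 * w x \<le> (2 * (cmod (b x))\<^sup>2 + 2 * (cmod (u x))\<^sup>2) * w x"
        using elim by (intro mult_right_mono) auto
      then show ?case using elim by (simp add: distrib_right mult.assoc)
    qed
    show "(\<lambda>x. (cmod (U n x - u x))\<^sup>2 * w x) \<in> borel_measurable lebesgue" for n
      using L2w_integrable_square[OF L2w_diff[OF UL u]] by auto
  qed simp
  then show "(\<lambda>n. (norm_w w (\<lambda>x. U n x - u x))\<^sup>2) \<longlonglongrightarrow> 0"
    unfolding norm_w_square by simp
qed

lemma approximable_add_mult:
  assumes S: "linear_subspace S"
    and u: "approximable S u" and v: "approximable S v"
  shows "approximable S (\<lambda>x. a * u x + b * v x)"
  unfolding approximable_def
proof (intro conjI allI impI)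
  have L: "u \<in> L2w w" "v \<in> L2w w" using u v by (auto simp: approximable_def)
  then show "(\<lambda>x. a * u x + b * v x) \<in> L2w w" by (intro L2w_add L2w_mult)
  fix e :: real assume e: "e > 0"
  define C where "C = 2 * (cmod a)\<^sup>2 + 2 * (cmod b)\<^sup>2 + 1"
  have C: "C > 0" by (simp add: C_def add_nonneg_pos)
  obtain f where f: "f \<in> S" "(norm_w w (\<lambda>x. f x - u x))\<^sup>2 < e / C"
    using u e C unfolding approximable_def by (meson divide_pos_pos)
  obtain g where g: "g \<in> S" "(norm_w w (\<lambda>x. g x - v x))\<^sup>2 < e / C"
    using v e C unfolding approximable_def by (meson divide_pos_pos)
  have fg: "f \<in> L2w w" "g \<in> L2w w" using f g linear_subspaceD(1)[OF S] by auto
  have "(norm_w w (\<lambda>x. a * (f x - u x) + b * (g x - v x)))\<^sup>2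
      \<le> 2 * (cmod a)\<^sup>2 * (norm_w w (\<lambda>x. f x - u x))\<^sup>2 + 2 * (cmod b)\<^sup>2 * (norm_w w (\<lambda>x. g x - v x))\<^sup>2"
    using norm_w_add_square_le[OF L2w_mult[OF L2w_diff[OF fg(1) L(1)], of a] L2w_mult[OF L2w_diff[OF fg(2) L(2)], of b]]
    by (simp add: norm_w_mult_square)
  also have "\<dots> \<le> 2 * (cmod a)\<^sup>2 * (e / C) + 2 * (cmod b)\<^sup>2 * (e / C)"
    using f g by (intro add_mono mult_left_mono) auto
  also have "\<dots> < (2 * (cmod a)\<^sup>2 + 2 * (cmod b)\<^sup>2 + 1) * (e / C)"
  proof -
    have "p * X + q * X < (p + q + 1) * X" if "X > 0" for p q X :: real
      using that by (simp add: distrib_right)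
    from this[of "e / C"] show ?thesis using e C by (simp only: divide_pos_pos)
  qed
  also have "\<dots> = e" using C by (simp add: C_def[symmetric])
  also have "(\<lambda>x. a * (f x - u x) + b * (g x - v x)) = (\<lambda>x. (a * f x + b * g x) - (a * u x + b * v x))"
    by (simp add: algebra_simps)
  finally show "\<exists>f\<in>S. (norm_w w (\<lambda>x. f x - (a * u x + b * v x)))\<^sup>2 < e"
    by (rule bexI[OF _ linear_subspaceD(3)[OF S f(1) g(1)]])
qed

text \<open>
  A measurable function is the pointwise limit of simple functions of at most twice its modulus.
\<close>

lemma approximable_if_indicators:
  assumes S: "linear_subspace S"
    and ind: "\<And>A. A \<in> sets lebesgue \<Longrightarrow> approximable S (indicator A)"
    and u: "u \<in> L2w w"
  shows "approximable S u"
proof -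
  obtain F where F: "\<And>i. simple_function lebesgue (F i)" "\<And>x. (\<lambda>i. F i x) \<longlonglongrightarrow> u x"
    "\<And>i x. cmod (F i x) \<le> 2 * cmod (u x)"
    using borel_measurable_implies_sequence_metric[OF L2w_measurable[OF u], of 0]
    by (auto simp: dist_norm)
  have simple: "approximable S f" if f: "simple_function lebesgue f" for f
  proof -
    have zero: "approximable S (\<lambda>x. 0)"
    proof -
      have "indicator {} = (\<lambda>x::real. 0 :: complex)" by auto
      then show ?thesis using ind[of "{}"] by simp
    qed
    have "approximable S (\<lambda>x. \<Sum>y\<in>Y. y * indicator (f -` {y}) x)" if "finite Y" for Y
      using that
    proof (induction Y)
      case empty
      then show ?case using zero by simp
    next
      case (insert y Y)
      have "f -` {y} \<in> sets lebesgue"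
        using simple_functionD(2)[OF f, of "{y}"] by simp
      from approximable_add_mult[OF S ind[OF this] insert.IH, of y 1]
      show ?case by (simp only: sum.insert[OF insert.hyps] mult_1_left)
    qed
    from this[of "range f"] have "approximable S (\<lambda>x. \<Sum>y\<in>range f. y * indicator (f -` {y}) x)"
      using simple_functionD(1)[OF f] by simp
    moreover have "(\<Sum>y\<in>range f. y * indicator (f -` {y}) x) = f x" for x
    proof -
      have "(\<Sum>y\<in>range f. y * indicator (f -` {y}) x) = (\<Sum>y\<in>range f. if y = f x then y else 0)"
        by (intro sum.cong) (auto simp: indicator_def)
      then show ?thesis using simple_functionD(1)[OF f] by simp
    qed
    ultimately show ?thesis by simp
  qed
  show ?thesis
  proof (rule approximable_dominated_limit[OF linear_subspaceD(1)[OF S] simple[OF F(1)] u L2w_mult[OF u, of 2]])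
    show "AE x in lebesgue. (\<lambda>i. F i x) \<longlonglongrightarrow> u x" using F(2) by simp
    show "cmod (F i x) \<le> cmod (2 * u x)" for i x using F(3) by (simp add: norm_mult)
  qed
qed

lemma L2w_indicator: "A \<in> sets lebesgue \<Longrightarrow> indicator A \<in> L2w w"
  by (rule L2w_bounded[of _ 1]) (auto simp: indicator_def)

lemma approximable_indicator:
  assumes S: "linear_subspace S"
    and half_line: "\<And>a. approximable S (indicator {..<a})"
    and A: "A \<in> sets lebesgue"
  shows "approximable S (indicator A)"
  using A
proof (induction rule: lebesgue_sets_induct)
  case empty
  have "indicator {} = (\<lambda>x::real. 0 :: complex)" by auto
  then show ?case using approximable_mem[OF linear_subspaceD(1,2)[OF S]] by simp
next
  case (lessThan a)
  then show ?case by (rule half_line)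
next
  case (compl A)
  have "approximable S (\<lambda>x. 1)"
  proof (rule approximable_dominated_limit[OF linear_subspaceD(1)[OF S] half_line L2w_const L2w_const[of 1]])
    have "(\<lambda>n. indicator {..<real n} x :: complex) \<longlonglongrightarrow> 1" for x
    proof (rule tendsto_eventually)
      obtain N where "x < real N" using reals_Archimedean2 by blast
      then show "eventually (\<lambda>n. indicator {..<real n} x = (1 :: complex)) sequentially"
        by (intro eventually_sequentiallyI[of N]) (auto simp: indicator_def)
    qed
    then show "AE x in lebesgue. (\<lambda>n. indicator {..<real n} x :: complex) \<longlonglongrightarrow> 1" by simp
  qed (auto simp: indicator_def)
  from approximable_add_mult[OF S this compl(2), of 1 "- 1"]
  have "approximable S (\<lambda>x. 1 - indicator A x)" by simp
  moreover have "(\<lambda>x. 1 - indicator A x :: complex) = indicator (- A)" by (auto simp: indicator_def)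
  ultimately show ?case by simp
next
  case (union A)
  have part: "approximable S (indicator (\<Union>i<n. A i))" for n
  proof (induction n)
    case 0
    have "indicator {} = (\<lambda>x::real. 0 :: complex)" by auto
    then show ?case using approximable_mem[OF linear_subspaceD(1,2)[OF S]] by simp
  next
    case (Suc n)
    have "A n \<inter> (\<Union>i<n. A i) = {}"
    proof -
      have "A n \<inter> A i = {}" if "i < n" for i
        using union(2) that unfolding disjoint_family_on_def by (metis UNIV_I less_irrefl)
      then show ?thesis by blast
    qed
    then have "indicator (\<Union>i<Suc n. A i) = (\<lambda>x. 1 * indicator (\<Union>i<n. A i) x + 1 * indicator (A n) x :: complex)"
      by (auto simp: indicator_def lessThan_Suc fun_eq_iff)
    then show ?case using approximable_add_mult[OF S Suc union(3)[of n], of 1 1] by simp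
  qed
  have "(\<Union>i. A i) \<in> sets lebesgue" using union(1) by auto
  then show ?case
  proof (intro approximable_dominated_limit[OF linear_subspaceD(1)[OF S] part L2w_indicator L2w_const[of 1]])
    have "(\<lambda>n. indicator (\<Union>i<n. A i) x :: complex) \<longlonglongrightarrow> indicator (\<Union>i. A i) x" for x
      by (rule LIMSEQ_indicator_UN)
    then show "AE x in lebesgue. (\<lambda>n. indicator (\<Union>i<n. A i) x :: complex) \<longlonglongrightarrow> indicator (\<Union>i. A i) x"
      by simp
  qed (auto simp: indicator_def)
next
  case (ae A B)
  show ?case
  proof (rule approximable_dominated_limit[OF linear_subspaceD(1)[OF S] ae(4) L2w_indicator[OF ae(2)] L2w_const[of 1]])
    show "AE x in lebesgue. (\<lambda>n. indicator A x :: complex) \<longlonglongrightarrow> indicator B x"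
      using ae(3) by eventually_elim (auto simp: indicator_def)
  qed (auto simp: indicator_def)
qed

definition mass :: "real set \<Rightarrow> real" where
  "mass A = (LINT x|lebesgue. indicator A x * w x)"

lemma integrable_indicator_weight: "A \<in> sets lebesgue \<Longrightarrow> integrable lebesgue (\<lambda>x. indicator A x * w x)"
  using integrable_mult_indicator[OF _ integrable_weight, of A] by simp

lemma mass_nonneg: "0 \<le> mass A"
  unfolding mass_def using AE_pos by (intro integral_nonneg_AE) (auto elim: eventually_mono)

lemma mass_mono:
  assumes "A \<in> sets lebesgue" "B \<in> sets lebesgue" "A \<subseteq> B"
  shows "mass A \<le> mass B"
  unfolding mass_def
proof (rule integral_mono_AE[OF integrable_indicator_weight integrable_indicator_weight])
  show "AE x in lebesgue. indicator A x * w x \<le> indicator B x * w x"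
    using AE_pos by eventually_elim (use assms in \<open>auto simp: indicator_def\<close>)
qed (use assms in auto)

lemma mass_pos:
  assumes A: "A \<in> sets lebesgue" and "emeasure lebesgue A \<noteq> 0"
  shows "0 < mass A"
proof -
  have "mass A \<noteq> 0"
  proof
    assume "mass A = 0"
    moreover have "AE x in lebesgue. 0 \<le> indicator A x * w x"
      using AE_pos by eventually_elim auto
    ultimately have "AE x in lebesgue. indicator A x * w x = 0"
      using integral_nonneg_eq_0_iff_AE[OF integrable_indicator_weight[OF A]] by (simp add: mass_def)
    then have "AE x in lebesgue. x \<notin> A"
      using AE_pos by eventually_elim (auto simp: indicator_def)
    then have "A \<in> null_sets lebesgue" using A by (subst AE_iff_null_sets)
    then show False using assms(2) by auto
  qed
  then show ?thesis using mass_nonneg[of A] by simp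
qed

text \<open>
  With \<open>mass\<close> the weighted measure, the primitive of an indicator is a ramp that grows from 0 to
  \<open>mass A\<close> while \<open>x\<close> passes through \<open>A\<close>.
\<close>

lemma cumulative_indicator:
  "cumulative (\<lambda>x. indicator A x) x = complex_of_real (mass (A \<inter> {..x}))"
proof -
  have "cumulative (\<lambda>x. indicator A x) x = (LINT t|lebesgue. complex_of_real (indicator (A \<inter> {..x}) t * w t))"
    unfolding cumulative_def primitive_def
    by (intro Bochner_Integration.integral_cong) (auto simp: indicator_def)
  then show ?thesis unfolding mass_def by (simp only: integral_complex_of_real)
qed

lemma integral_w_indicator: "integral_w (\<lambda>x. indicator A x) = complex_of_real (mass A)"
proof -
  have "integral_w (\<lambda>x. indicator A x) = (LINT t|lebesgue. complex_of_real (indicator A t * w t))"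
    unfolding integral_w_def
    by (intro Bochner_Integration.integral_cong) (auto simp: indicator_def)
  then show ?thesis unfolding mass_def by (simp only: integral_complex_of_real)
qed

text \<open>
  If \<open>A\<close> lies to the left of \<open>B\<close>, this function climbs from 0 to 1 along \<open>A\<close>, stays at 1, and returns
  to 0 along \<open>B\<close>. Climbing in proportion to the weighted measure keeps \<open>H_w\<close> of it bounded, however
  small the weight is; a smooth cut-off need not have this property.
\<close>

definition trapezoid :: "real set \<Rightarrow> real set \<Rightarrow> real \<Rightarrow> real" where
  "trapezoid A B x = mass (A \<inter> {..x}) / mass A - mass (B \<inter> {..x}) / mass B"

text \<open>
  The function vanishes at both ends of the line, so that the boundary condition holds for every \<open>\<alpha>\<close>.
\<close>

lemma trapezoid_in_domain:
  assumes A: "A \<in> sets lebesgue" "mass A > 0" and B: "B \<in> sets lebesgue" "mass B > 0"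
  shows "(\<lambda>x. complex_of_real (trapezoid A B x)) \<in> Domain (operator_graph w (D_alpha w \<alpha>) (H_w w))"
proof -
  let ?a = "- \<i> / complex_of_real (mass A)" and ?b = "\<i> / complex_of_real (mass B)"
  let ?g = "\<lambda>x. ?a * indicator A x + ?b * indicator B x"
  have L: "(\<lambda>x. indicator A x) \<in> L2w w" "(\<lambda>x. indicator B x) \<in> L2w w"
    using L2w_indicator A(1) B(1) by auto
  have g: "?g \<in> L2w w" by (intro L2w_add L2w_mult L)
  have "\<i> * cumulative ?g x = complex_of_real (trapezoid A B x)" for x
    unfolding cumulative_add_mult[OF L] cumulative_indicator trapezoid_def
    by (simp add: algebra_simps)
  moreover have "\<i> * integral_w ?g = 0"
    unfolding integral_w_add_mult[OF L] integral_w_indicator using A B by simp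
  moreover from calculation have "(\<lambda>x. complex_of_real (trapezoid A B x)) = (\<lambda>x. \<i> * cumulative ?g x)"
    by simp
  then have "(\<lambda>x. complex_of_real (trapezoid A B x)) \<in> L2w w"
    using L2w_mult[OF L2w_cumulative[OF g], of \<i>] by simp
  ultimately have "(\<lambda>x. complex_of_real (trapezoid A B x), ?g) \<in> operator_graph w (D_alpha w \<alpha>) (H_w w)"
    unfolding graph_iff using g by (intro conjI exI[of _ 0]) auto
  then show ?thesis by blast
qed

lemma abs_trapezoid_le:
  assumes "A \<in> sets lebesgue" "B \<in> sets lebesgue"
  shows "\<bar>trapezoid A B x\<bar> \<le> 1"
proof -
  have "0 \<le> mass (C \<inter> {..x}) / mass C \<and> mass (C \<inter> {..x}) / mass C \<le> 1" if "C \<in> sets lebesgue" for C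
  proof -
    have "C \<inter> {..x} \<in> sets lebesgue" using that by (intro sets.Int) auto
    then have "mass (C \<inter> {..x}) \<le> mass C" by (intro mass_mono that) auto
    then show ?thesis
      using mass_nonneg[of C] mass_nonneg[of "C \<inter> {..x}"] by (auto simp: divide_le_eq)
  qed
  from this[OF assms(1)] this[OF assms(2)] show ?thesis
    unfolding trapezoid_def by linarith
qed

text \<open>
  Trapezoids whose ascent moves off to minus infinity and whose descent contracts to \<open>b\<close> from the
  left converge to the indicator of the half-line.
\<close>

lemma approximable_half_line:
  "approximable (Domain (operator_graph w (D_alpha w \<alpha>) (H_w w))) (indicator {..<b})"
    (is "approximable ?S _")
proof -
  \<comment> \<open>The shift by \<open>Suc n\<close> keeps \<open>A n\<close> to the left of \<open>B n\<close> from the start.\<close>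
  define A where "A n = {b - 1 - real (Suc n)..b - real (Suc n)}" for n
  define B where "B n = {b - 1 / real (Suc n)..b}" for n
  have S: "?S \<subseteq> L2w w" by (auto simp: graph_iff)
  have sets: "A n \<in> sets lebesgue" "B n \<in> sets lebesgue" for n by (auto simp: A_def B_def)
  have pos: "0 < mass (A n)" "0 < mass (B n)" for n
    by (intro mass_pos sets; simp add: A_def B_def)+
  have approx: "approximable ?S (\<lambda>x. complex_of_real (trapezoid (A n) (B n) x))" for n
    by (intro approximable_mem S trapezoid_in_domain sets pos)
  have lim: "(\<lambda>n. complex_of_real (trapezoid (A n) (B n) x)) \<longlonglongrightarrow> indicator {..<b} x" if "x \<noteq> b" for x
  proof (rule tendsto_eventually)
    show "eventually (\<lambda>n. complex_of_real (trapezoid (A n) (B n) x) = indicator {..<b} x) sequentially"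
    proof (cases "x < b")
      case True
      obtain N where N: "b - x < real N" using reals_Archimedean2 by blast
      have "(\<lambda>n. b - 1 / real (Suc n)) \<longlonglongrightarrow> b - 0"
        using LIMSEQ_inverse_real_of_nat by (intro tendsto_intros) (simp add: inverse_eq_divide)
      then have "eventually (\<lambda>n. x < b - 1 / real (Suc n)) sequentially"
        using True by (intro order_tendstoD) auto
      then show ?thesis using eventually_ge_at_top[of N]
      proof eventually_elim
        case (elim n)
        have "A n \<inter> {..x} = A n" using elim N by (auto simp: A_def)
        moreover have "B n \<inter> {..x} = {}" using elim by (auto simp: B_def)
        ultimately show ?case
          using pos(1)[of n] True by (simp add: trapezoid_def mass_def[of "{}"])
      qed
    next
      case False
      have "trapezoid (A n) (B n) x = 0" for n
      proof -
        have "A n \<inter> {..x} = A n" "B n \<inter> {..x} = B n" using False by (auto simp: A_def B_def)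
        then show ?thesis using pos[of n] by (simp add: trapezoid_def)
      qed
      then show ?thesis using False by simp
    qed
  qed
  show ?thesis
  proof (rule approximable_dominated_limit[OF S approx L2w_indicator L2w_const[of 1]])
    show "AE x in lebesgue. (\<lambda>n. complex_of_real (trapezoid (A n) (B n) x)) \<longlonglongrightarrow> indicator {..<b} x"
      using AE_neq_lebesgue[of b] by eventually_elim (rule lim)
    show "cmod (complex_of_real (trapezoid (A n) (B n) x)) \<le> cmod 1" for n x
      using abs_trapezoid_le[OF sets] by simp
  qed auto
qed

lemma densely_defined_graph:
  "densely_defined_w w (operator_graph w (D_alpha w \<alpha>) (H_w w))"
proof -
  let ?G = "operator_graph w (D_alpha w \<alpha>) (H_w w)"
  have S: "linear_subspace (Domain ?G)"
    unfolding linear_subspace_def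
  proof (intro conjI ballI allI)
    show "Domain ?G \<subseteq> L2w w" by (auto simp: graph_iff)
    show "(\<lambda>x. 0) \<in> Domain ?G"
      using linear_operator_graph[of \<alpha>] unfolding linear_operator_w_def by blast
    fix f f' a b assume "f \<in> Domain ?G" "f' \<in> Domain ?G"
    then obtain g g' where gg: "(f, g) \<in> ?G" "(f', g') \<in> ?G" by blast
    have add: "(\<lambda>x. p x + p' x, \<lambda>x. q x + q' x) \<in> ?G" if "(p, q) \<in> ?G" "(p', q') \<in> ?G" for p q p' q'
      using linear_operator_graph[of \<alpha>] that unfolding linear_operator_w_def by blast
    have mult: "(\<lambda>x. c * p x, \<lambda>x. c * q x) \<in> ?G" if "(p, q) \<in> ?G" for c p q
      using linear_operator_graph[of \<alpha>] that unfolding linear_operator_w_def by blast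
    from add[OF mult[OF gg(1), of a] mult[OF gg(2), of b]]
    show "(\<lambda>x. a * f x + b * f' x) \<in> Domain ?G" by blast
  qed
  have approx: "approximable (Domain ?G) u" if "u \<in> L2w w" for u
    using approximable_if_indicators[OF S
        approximable_indicator[OF S approximable_half_line] that] .
  show ?thesis
    unfolding densely_defined_w_def
  proof (intro ballI allI impI)
    fix u and e :: real assume u: "u \<in> L2w w" and e: "e > 0"
    from approx[OF u] e obtain f where f: "f \<in> Domain ?G" "(norm_w w (\<lambda>x. f x - u x))\<^sup>2 < e\<^sup>2"
      unfolding approximable_def by (meson zero_less_power)
    then have "norm_w w (\<lambda>x. f x - u x) < e"
      using e power2_less_imp_less[of "norm_w w (\<lambda>x. f x - u x)" e] by simp
    with f show "\<exists>f\<in>Domain ?G. norm_w w (\<lambda>x. f x - u x) < e" by blast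
  qed
qed

end

section \<open>Essential self-adjointness\<close>

text \<open>
  The operator coincides with its adjoint, and an adjoint is closed; hence it is its own closure.
  Symmetry is the inclusion of the graph in the adjoint.
\<close>

theorem theorem1p4:
  fixes w :: "real \<Rightarrow> real" and \<alpha> :: complex
  assumes w_pos: "AE x in lebesgue. 0 < w x"
    and w_L1: "integrable lebesgue w"
    and w_Linf: "\<exists>C. AE x in lebesgue. \<bar>w x\<bar> \<le> C"
    and alpha: "cmod \<alpha> = 1"
  shows "essentially_self_adjoint_w w (operator_graph w (D_alpha w \<alpha>) (H_w w))"
proof -
  interpret integrable_weight w by unfold_locales (fact w_pos w_L1)+
  let ?G = "operator_graph w (D_alpha w \<alpha>) (H_w w)"
  have adj: "adjoint_w w ?G = ?G"
    using graph_subset_adjoint[OF alpha] adjoint_subset_graph[OF alpha] by (rule equalityI[rotated])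
  have L: "?G \<subseteq> L2w w \<times> L2w w" by (auto simp: graph_iff)
  have "closure_w w ?G \<subseteq> ?G"
    using closure_subset_adjoint[OF L] unfolding adj by blast
  then have "closure_w w ?G = ?G"
    using subset_closure[OF L] by blast
  moreover have "symmetric_w w ?G"
    using adj unfolding symmetric_w_def adjoint_w_def by blast
  ultimately show ?thesis
    using linear_operator_graph densely_defined_graph adj
    by (simp add: essentially_self_adjoint_w_def self_adjoint_w_def)
qed

end
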